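(* Associated to a presentation $\mathcal{P}$ is a well-defined Steinitz number $\xi(\mathcal{P})$, and the type $\tau[\xi(\mathcal{P})]$ depends only on the homeomorphism class of $\mathcal{M}_{\mathcal{P}}$; that is, if $\mathcal{P}$ and $\mathcal{P}'$ are presentations such that the solenoidal manifolds $\mathcal{M}_{\mathcal{P}}$ and $\mathcal{M}_{\mathcal{P}'}$ are homeomorphic, then $\tau[\xi(\mathcal{P})]=\tau[\xi(\mathcal{P}')]$. (This type is denoted by $\tau[\mathcal{M}_{\mathcal{P}}]$.)
   Context: A presentation is a sequence of proper finite covering maps $\mathcal{P}=\{q_\ell\colon M_\ell\to M_{\ell-1}\mid\ell\ge1\}$, where each $M_\ell$ is a compact connected manifold without boundary of dimension $n$ (proper meaning covering degree greater than one). The associated solenoidal manifold (weak solenoid) is the inverse limit $\mathcal{M}_{\mathcal{P}}=\varprojlim\{q_\ell\colon M_\ell\to M_{\ell-1}\}\subset\prod_{\ell\ge0}M_\ell$ with the topology induced from the product topology. Let $m_\ell$ be the covering degree of $q_\ell$. The Steinitz order of $\mathcal{P}$ is $\xi(\mathcal{P})=\mathrm{lcm}\{m_1m_2\cdots m_\ell\mid\ell>0\}$. A Steinitz number is a formal product $\xi=\prod_{p}p^{\chi_\xi(p)}$ over all primes $p$, with $\chi_\xi(p)\in\{0,1,\ldots,\infty\}$; the least common multiple of a collection of positive integers is a Steinitz number, with exponent at $p$ the supremum of the exponents. $\xi,\xi'$ are asymptotically equivalent if there are integers $m,m'\ge1$ with $m\cdot\xi=m'\cdot\xi'$; the equivalence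 class of $\xi$ is its type $\tau[\xi]$. *)

theory Defs
  imports
    "HOL-Analysis.Analysis"
    "HOL-Computational_Algebra.Computational_Algebra"
    "HOL-Library.Extended_Nat"
begin

section \<open>Topological manifolds\<close>

definition second_countable_space :: "'a topology \<Rightarrow> bool" where
  "second_countable_space X \<longleftrightarrow>
     (\<exists>\<B>. countable \<B> \<and> (\<forall>B\<in>\<B>. openin X B) \<and>
        (\<forall>U x. openin X U \<and> x \<in> U \<longrightarrow> (\<exists>B\<in>\<B>. x \<in> B \<and> B \<subseteq> U)))"

definition locally_Euclidean_space :: "nat \<Rightarrow> 'a topology \<Rightarrow> bool" where
  "locally_Euclidean_space n X \<longleftrightarrow>
     (\<forall>x \<in> topspace X. \<exists>U V. openin X U \<and> x \<in> U \<and> openin (Euclidean_space n) V \<and>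
        subtopology X U homeomorphic_space subtopology (Euclidean_space n) V)"

text \<open>Every point has a chart onto an open subset of the whole Euclidean space (not of a
  half-space), so these manifolds have no boundary.\<close>

definition manifold_without_boundary :: "nat \<Rightarrow> 'a topology \<Rightarrow> bool" where
  "manifold_without_boundary n X \<longleftrightarrow>
     Hausdorff_space X \<and> second_countable_space X \<and> locally_Euclidean_space n X"

section \<open>Finite covering maps\<close>

text \<open>The library constant \<^const>\<open>covering_space\<close> is restricted to subsets of type-class
  topological spaces; the following is the same definition for abstract topologies.\<close>

definition covering_map :: "'a topology \<Rightarrow> 'b topology \<Rightarrow> ('a \<Rightarrow> 'b) \<Rightarrow> bool" where
  "covering_map X Y p \<longleftrightarrow>
     continuous_map X Y p \<and> p ` topspace X = topspace Y \<and>
     (\<forall>y \<in> topspace Y. \<exists>V. y \<in> V \<and> openin Y V \<and>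
        (\<exists>\<U>. \<Union>\<U> = topspace X \<inter> p -` V \<and>
             (\<forall>U\<in>\<U>. openin X U) \<and>
             pairwise disjnt \<U> \<and>
             (\<forall>U\<in>\<U>. homeomorphic_map (subtopology X U) (subtopology Y V) p)))"

definition fibre :: "'a topology \<Rightarrow> ('a \<Rightarrow> 'b) \<Rightarrow> 'b \<Rightarrow> 'a set" where
  "fibre X p y = {x \<in> topspace X. p x = y}"

definition finite_covering_map :: "'a topology \<Rightarrow> 'b topology \<Rightarrow> ('a \<Rightarrow> 'b) \<Rightarrow> bool" where
  "finite_covering_map X Y p \<longleftrightarrow>
     covering_map X Y p \<and> (\<forall>y \<in> topspace Y. finite (fibre X p y))"

definition has_covering_degree :: "'a topology \<Rightarrow> 'b topology \<Rightarrow> ('a \<Rightarrow> 'b) \<Rightarrow> nat \<Rightarrow> bool" where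
  "has_covering_degree X Y p d \<longleftrightarrow>
     (\<forall>y \<in> topspace Y. finite (fibre X p y) \<and> card (fibre X p y) = d)"

text \<open>Meaningful for finite covering maps onto a nonempty connected space, where the number of
  points in a fibre is constant.\<close>

definition covering_degree :: "'a topology \<Rightarrow> 'b topology \<Rightarrow> ('a \<Rightarrow> 'b) \<Rightarrow> nat" where
  "covering_degree X Y p = (THE d. has_covering_degree X Y p d)"

definition proper_finite_covering_map :: "'a topology \<Rightarrow> 'b topology \<Rightarrow> ('a \<Rightarrow> 'b) \<Rightarrow> bool" where
  "proper_finite_covering_map X Y p \<longleftrightarrow>
     finite_covering_map X Y p \<and> 1 < covering_degree X Y p"

section \<open>Presentations and solenoidal manifolds\<close>

text \<open>The bonding maps are \<open>q l : M l \<rightarrow> M (l - 1)\<close> for \<open>l \<ge> 1\<close>; the value \<open>q 0\<close> is irrelevant.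
  Nonemptiness is required explicitly because \<^const>\<open>connected_space\<close> admits the empty space.\<close>

definition presentation :: "nat \<Rightarrow> (nat \<Rightarrow> 'a topology) \<Rightarrow> (nat \<Rightarrow> 'a \<Rightarrow> 'a) \<Rightarrow> bool" where
  "presentation n M q \<longleftrightarrow>
     (\<forall>l. topspace (M l) \<noteq> {} \<and> compact_space (M l) \<and> connected_space (M l) \<and>
          manifold_without_boundary n (M l)) \<and>
     (\<forall>l\<ge>1. proper_finite_covering_map (M l) (M (l - 1)) (q l))"

definition solenoidal_manifold :: "(nat \<Rightarrow> 'a topology) \<Rightarrow> (nat \<Rightarrow> 'a \<Rightarrow> 'a) \<Rightarrow> (nat \<Rightarrow> 'a) topology" where
  "solenoidal_manifold M q =
     subtopology (product_topology M UNIV) {x. \<forall>l\<ge>1. q l (x l) = x (l - 1)}"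

section \<open>Steinitz numbers\<close>

text \<open>A Steinitz number is given by its exponents at the primes; the exponent function is
  normalised to be zero at non-primes.\<close>

typedef steinitz = "{e :: nat \<Rightarrow> enat. \<forall>p. \<not> prime p \<longrightarrow> e p = 0}"
  morphisms steinitz_exponent Abs_steinitz
  by (rule exI[of _ "\<lambda>_. 0"]) simp

setup_lifting type_definition_steinitz

instantiation steinitz :: comm_monoid_mult
begin

lift_definition one_steinitz :: steinitz is "\<lambda>_. 0"
  by simp

lift_definition times_steinitz :: "steinitz \<Rightarrow> steinitz \<Rightarrow> steinitz" is "\<lambda>e f p. e p + f p"
  by simp

instance
  by standard (transfer; simp add: fun_eq_iff ac_simps)+

end

text \<open>The conversion is meaningful for positive integers only.\<close>

lift_definition steinitz_of_nat :: "nat \<Rightarrow> steinitz" is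
  "\<lambda>m p. if prime p then enat (multiplicity p m) else 0"
  by simp

lift_definition steinitz_Lcm :: "nat set \<Rightarrow> steinitz" is
  "\<lambda>A p. if prime p then (SUP a\<in>A. enat (multiplicity p a)) else 0"
  by simp

definition asymptotically_equivalent :: "steinitz \<Rightarrow> steinitz \<Rightarrow> bool" where
  "asymptotically_equivalent \<xi> \<xi>' \<longleftrightarrow>
     (\<exists>m m'. 1 \<le> m \<and> 1 \<le> m' \<and> steinitz_of_nat m * \<xi> = steinitz_of_nat m' * \<xi>')"

definition steinitz_type :: "steinitz \<Rightarrow> steinitz set" where
  "steinitz_type \<xi> = {\<xi>'. asymptotically_equivalent \<xi> \<xi>'}"

lemma steinitz_of_nat_mult:
  assumes "1 \<le> m" "1 \<le> k"
  shows "steinitz_of_nat (m * k) = steinitz_of_nat m * steinitz_of_nat k"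
  using assms
  by transfer (auto simp: fun_eq_iff prime_elem_multiplicity_mult_distrib)

lemma equivp_asymptotically_equivalent: "equivp asymptotically_equivalent"
proof (rule equivpI)
  show "reflp asymptotically_equivalent"
    by (auto simp: reflp_def asymptotically_equivalent_def)
  show "symp asymptotically_equivalent"
    unfolding symp_def asymptotically_equivalent_def by metis
  show "transp asymptotically_equivalent"
  proof (rule transpI)
    fix x y z
    assume "asymptotically_equivalent x y" "asymptotically_equivalent y z"
    then obtain a b c d where pos: "1 \<le> a" "1 \<le> b" "1 \<le> c" "1 \<le> d"
      and ab: "steinitz_of_nat a * x = steinitz_of_nat b * y"
      and cd: "steinitz_of_nat c * y = steinitz_of_nat d * z"
      unfolding asymptotically_equivalent_def by metis
    have "steinitz_of_nat (c * a) * x = steinitz_of_nat (b * d) * z"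
      unfolding steinitz_of_nat_mult[OF pos(3,1)] steinitz_of_nat_mult[OF pos(2,4)]
      using ab cd by (metis mult.assoc mult.left_commute)
    moreover have "1 \<le> c * a" "1 \<le> b * d"
      using pos by auto
    ultimately show "asymptotically_equivalent x z"
      unfolding asymptotically_equivalent_def by blast
  qed
qed

lemma steinitz_type_eq_iff:
  "steinitz_type \<xi> = steinitz_type \<xi>' \<longleftrightarrow> asymptotically_equivalent \<xi> \<xi>'"
  using equivp_asymptotically_equivalent
  unfolding steinitz_type_def equivp_def by auto

section \<open>The Steinitz order of a presentation\<close>

definition is_steinitz_order ::
    "(nat \<Rightarrow> 'a topology) \<Rightarrow> (nat \<Rightarrow> 'a \<Rightarrow> 'a) \<Rightarrow> steinitz \<Rightarrow> bool" where
  "is_steinitz_order M q \<xi> \<longleftrightarrow>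
     (\<exists>m. (\<forall>l\<ge>1. has_covering_degree (M l) (M (l - 1)) (q l) (m l)) \<and>
          \<xi> = steinitz_Lcm {\<Prod>i=1..l. m i |l. l > 0})"

definition steinitz_order :: "(nat \<Rightarrow> 'a topology) \<Rightarrow> (nat \<Rightarrow> 'a \<Rightarrow> 'a) \<Rightarrow> steinitz" where
  "steinitz_order M q = (THE \<xi>. is_steinitz_order M q \<xi>)"

end

theory Submission
  imports Defs
begin

text \<open>The fundamental groups never appear; their role is played by counting sheets. Over a small
  coordinate ball of the base manifold a solenoid is a product of the ball with a Cantor set: all
  coverings of a ball are trivial, so every point of the solenoid lies on a unique connected plaque
  that is a section over the ball. Writing \<open>m\<^sub>1 \<cdots> m\<^sub>e\<close> for the degree of the \<open>e\<close>-th manifold over the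
  base, the proportion of the level-\<open>e\<close> sheets met by a compact transversal, as \<open>e\<close> grows, is its
  transverse measure.

  Let \<open>h\<close> be a homeomorphism onto a second solenoid, with degrees \<open>m'\<close>. For \<open>c\<close> large and \<open>d \<ge> c\<close> let
  \<open>K\<close> be the fibre of the first solenoid over a point of its \<open>d\<close>-th manifold. Then \<open>h K\<close> lies over one
  coordinate ball, and the number of level-\<open>e\<close> sheets it meets is locally constant in the point, hence
  constant. The fibre over a point \<open>x\<close> of the \<open>c\<close>-th manifold is the disjoint union of
  \<open>m\<^bsub>c+1\<^esub> \<cdots> m\<^sub>d\<close> such fibres; \<open>h\<close> maps it injectively and openly to the transversal, so for \<open>e\<close> large
  the pieces meet different sheets and the whole meets \<open>r m'\<^bsub>k+1\<^esub> \<cdots> m'\<^sub>e\<close> of them, where \<open>k\<close> and \<open>r\<close>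
  depend on \<open>x\<close> only. Hence \<open>m\<^bsub>c+1\<^esub> \<cdots> m\<^sub>d\<close> divides \<open>r m'\<^sub>1 \<cdots> m'\<^sub>e\<close>, and with the symmetric statement
  each Steinitz order divides an integer multiple of the other.\<close>

section \<open>Coverings: local sections, uniqueness of lifts, and the number of sheets\<close>

section \<open>Covering maps of abstract topologies\<close>

lemma covering_map_continuous: "covering_map X Y p \<Longrightarrow> continuous_map X Y p"
  by (simp add: covering_map_def)

lemma covering_map_evenly_covered:
  assumes "covering_map X Y p" "y \<in> topspace Y"
  obtains V \<U> where "y \<in> V" "openin Y V" "\<Union>\<U> = topspace X \<inter> p -` V"
    "\<And>U. U \<in> \<U> \<Longrightarrow> openin X U" "pairwise disjnt \<U>"
    "\<And>U. U \<in> \<U> \<Longrightarrow> homeomorphic_map (subtopology X U) (subtopology Y V) p"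
proof -
  from assms have "\<exists>V. y \<in> V \<and> openin Y V \<and>
        (\<exists>\<U>. \<Union>\<U> = topspace X \<inter> p -` V \<and>
             (\<forall>U\<in>\<U>. openin X U) \<and>
             pairwise disjnt \<U> \<and>
             (\<forall>U\<in>\<U>. homeomorphic_map (subtopology X U) (subtopology Y V) p))"
    by (simp add: covering_map_def)
  then show thesis
    by (elim exE conjE) (rule that, assumption+, erule (1) bspec, assumption, erule (1) bspec)
qed

lemma covering_map_locally_injective:
  assumes "covering_map X Y p" "z \<in> topspace X"
  obtains U where "openin X U" "z \<in> U" "inj_on p U"
proof -
  have "p z \<in> topspace Y"
    using assms covering_map_continuous continuous_map_image_subset_topspace by blast
  from covering_map_evenly_covered[OF assms(1) this]
  obtain V \<U> where V: "p z \<in> V" "openin Y V" "\<Union>\<U> = topspace X \<inter> p -` V"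
    and U: "\<And>U. U \<in> \<U> \<Longrightarrow> openin X U" "pairwise disjnt \<U>"
    "\<And>U. U \<in> \<U> \<Longrightarrow> homeomorphic_map (subtopology X U) (subtopology Y V) p"
    by blast
  obtain U where "U \<in> \<U>" "z \<in> U"
    using V assms(2) by blast
  then show thesis
    using that U homeomorphic_imp_injective_map[OF U(3)[OF \<open>U \<in> \<U>\<close>]] openin_subset
    by (metis topspace_subtopology_subset)
qed

text \<open>The section is the inverse of \<open>p\<close> on the sheet through \<open>z\<close>.
  The set \<open>V\<close> is fixed before \<open>z\<close>, so one neighbourhood serves all points
  above it; lifting from every starting point of a small box relies on this.\<close>

lemma covering_map_local_section:
  assumes "covering_map X Y p" "y \<in> topspace Y"
  obtains V where "openin Y V" "y \<in> V"
    "\<And>z. z \<in> topspace X \<Longrightarrow> p z \<in> V \<Longrightarrow>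
      \<exists>g. continuous_map (subtopology Y V) X g \<and> (\<forall>v\<in>V. p (g v) = v) \<and> g (p z) = z"
proof -
  from covering_map_evenly_covered[OF assms]
  obtain V \<U> where V: "y \<in> V" "openin Y V" "\<Union>\<U> = topspace X \<inter> p -` V"
    and U: "\<And>U. U \<in> \<U> \<Longrightarrow> openin X U" "pairwise disjnt \<U>"
    "\<And>U. U \<in> \<U> \<Longrightarrow> homeomorphic_map (subtopology X U) (subtopology Y V) p"
    by blast
  show thesis
  proof (rule that[OF V(2,1)])
    fix z assume "z \<in> topspace X" "p z \<in> V"
    then obtain U where U': "U \<in> \<U>" "z \<in> U"
      using V by blast
    have sub: "topspace (subtopology X U) = U" "topspace (subtopology Y V) = V"
      using U(1)[OF U'(1)] V(2) openin_subset by (metis topspace_subtopology_subset)+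
    obtain g where g: "homeomorphic_maps (subtopology X U) (subtopology Y V) p g"
      using U(3)[OF U'(1)] homeomorphic_map_maps by blast
    then have "continuous_map (subtopology Y V) X g" "\<forall>v\<in>V. p (g v) = v" "g (p z) = z"
      using U'(2) sub unfolding homeomorphic_maps_def by (auto simp: continuous_map_in_subtopology)
    then show "\<exists>g. continuous_map (subtopology Y V) X g \<and> (\<forall>v\<in>V. p (g v) = v) \<and> g (p z) = z"
      by blast
  qed
qed

text \<open>The coincidence set is closed because \<open>X\<close> is Hausdorff, open because
  \<open>p\<close> is locally injective, and contains \<open>t0\<close>.\<close>

lemma covering_map_unique_lift:
  assumes cov: "covering_map X Y p" and haus: "Hausdorff_space X" and conn: "connected_space T"
    and f: "continuous_map T X f" and g: "continuous_map T X g"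
    and eq: "\<And>t. t \<in> topspace T \<Longrightarrow> p (f t) = p (g t)"
    and t0: "t0 \<in> topspace T" "f t0 = g t0" and t: "t \<in> topspace T"
  shows "f t = g t"
proof -
  let ?A = "{t \<in> topspace T. f t = g t}"
  have "closedin T ?A"
    by (rule closedin_continuous_maps_eq[OF haus f g])
  moreover have "openin T ?A"
  proof (subst openin_subopen, intro ballI)
    fix s assume s: "s \<in> ?A"
    then have "f s \<in> topspace X"
      using f continuous_map_image_subset_topspace by blast
    then obtain U where U: "openin X U" "f s \<in> U" "inj_on p U"
      using covering_map_locally_injective[OF cov] by metis
    let ?B = "{t \<in> topspace T. f t \<in> U} \<inter> {t \<in> topspace T. g t \<in> U}"
    have "openin T ?B"
      using U f g by (intro openin_Int openin_continuous_map_preimage)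
    moreover have "s \<in> ?B"
      using s U by auto
    moreover have "?B \<subseteq> ?A"
      using U(3) eq by (auto dest: inj_onD)
    ultimately show "\<exists>B. openin T B \<and> s \<in> B \<and> B \<subseteq> ?A"
      by blast
  qed
  ultimately have "?A = {} \<or> ?A = topspace T"
    using conn unfolding connected_space_clopen_in by blast
  then show ?thesis
    using t0 t by blast
qed

text \<open>Both the level set of \<open>f\<close> through \<open>x\<close> and its complement are
  open. The codomain carries no topology; the lemma serves for fibre sizes and for sheet
  counts.\<close>

lemma connected_space_locally_constant:
  assumes conn: "connected_space X"
    and loc: "\<And>x. x \<in> topspace X \<Longrightarrow> \<exists>U. openin X U \<and> x \<in> U \<and> (\<forall>y\<in>U. f y = f x)"
    and "x \<in> topspace X" "y \<in> topspace X"
  shows "f x = f y"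
proof -
  have "openin X {z \<in> topspace X. P (f z)}" for P
  proof (subst openin_subopen, intro ballI)
    fix z assume z: "z \<in> {z \<in> topspace X. P (f z)}"
    then obtain U where U: "openin X U" "z \<in> U" "\<forall>y\<in>U. f y = f z"
      using loc[of z] by (elim CollectE conjE) blast
    have "U \<subseteq> {z \<in> topspace X. P (f z)}"
    proof
      fix y assume "y \<in> U"
      then have "f y = f z" "y \<in> topspace X"
        using U(3) openin_subset[OF U(1)] by blast+
      then show "y \<in> {z \<in> topspace X. P (f z)}"
        using z by simp
    qed
    then show "\<exists>B. openin X B \<and> z \<in> B \<and> B \<subseteq> {z \<in> topspace X. P (f z)}"
      using U by blast
  qed
  from this[of "\<lambda>a. a = f x"] this[of "\<lambda>a. a \<noteq> f x"]
  have "openin X {z \<in> topspace X. f z = f x}" "closedin X {z \<in> topspace X. f z = f x}"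
    using set_diff_eq[of "topspace X" "{z \<in> topspace X. f z = f x}"]
    by (simp_all add: closedin_def Collect_restrict cong: conj_cong)
  then have "{z \<in> topspace X. f z = f x} = {} \<or> {z \<in> topspace X. f z = f x} = topspace X"
    using conn unfolding connected_space_clopen_in by blast
  then show ?thesis
    using assms(3,4) by (metis (mono_tags, lifting) empty_iff mem_Collect_eq)
qed

text \<open>Over an evenly covered set each sheet holds exactly one point of every fibre, so the
  fibre size is the number of sheets there, a locally constant quantity.\<close>

lemma covering_degree_exists:
  assumes "finite_covering_map X Y p" "connected_space Y"
  shows "\<exists>d. has_covering_degree X Y p d"
proof (cases "topspace Y = {}")
  case True
  then show ?thesis by (simp add: has_covering_degree_def)
next
  case False
  have cov: "covering_map X Y p" and fin: "\<And>y. y \<in> topspace Y \<Longrightarrow> finite (fibre X p y)"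
    using assms by (auto simp: finite_covering_map_def)
  have "\<exists>V. openin Y V \<and> y \<in> V \<and> (\<forall>v\<in>V. card (fibre X p v) = card (fibre X p y))"
    if y: "y \<in> topspace Y" for y
  proof -
    from covering_map_evenly_covered[OF cov y]
    obtain V \<U> where V: "y \<in> V" "openin Y V" "\<Union>\<U> = topspace X \<inter> p -` V"
    and U: "\<And>U. U \<in> \<U> \<Longrightarrow> openin X U" "pairwise disjnt \<U>"
    "\<And>U. U \<in> \<U> \<Longrightarrow> homeomorphic_map (subtopology X U) (subtopology Y V) p"
    by blast
    have im: "p ` U = V" and inj: "inj_on p U" if "U \<in> \<U>" for U
    proof -
      have "topspace (subtopology X U) = U" "topspace (subtopology Y V) = V"
        using U(1)[OF that] V(2) openin_subset by (metis topspace_subtopology_subset)+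
      then show "p ` U = V" "inj_on p U"
        using U(3)[OF that] homeomorphic_imp_surjective_map homeomorphic_imp_injective_map
        by metis+
    qed
    have "card (fibre X p v) = card \<U>" if v: "v \<in> V" for v
    proof -
      define pick where "pick U = the_inv_into U p v" for U
      have pick: "pick U \<in> U" "p (pick U) = v" if "U \<in> \<U>" for U
        using that im inj v unfolding pick_def by (auto simp: the_inv_into_into f_the_inv_into_f)
      have "inj_on pick \<U>"
      proof (rule inj_onI, rule ccontr)
        fix A B assume "A \<in> \<U>" "B \<in> \<U>" "pick A = pick B" "A \<noteq> B"
        then show False
          using pick(1)[of A] pick(1)[of B] pairwiseD[OF U(2), of A B] by (auto simp: disjnt_iff)
      qed
      moreover have "pick ` \<U> = fibre X p v"
      proof (intro equalityI subsetI)
        fix x assume "x \<in> pick ` \<U>"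
        then show "x \<in> fibre X p v"
          using pick openin_subset[OF U(1)] by (auto simp: fibre_def)
      next
        fix x assume x: "x \<in> fibre X p v"
        then obtain U where "U \<in> \<U>" "x \<in> U"
          using V(3) v unfolding fibre_def by blast
        then show "x \<in> pick ` \<U>"
          using x inj by (auto simp: pick_def fibre_def the_inv_into_f_f intro!: image_eqI[of _ _ U])
      qed
      ultimately show ?thesis
        by (metis card_image)
    qed
    then show ?thesis
      using V by metis
  qed
  then have "card (fibre X p y) = card (fibre X p y')" if "y \<in> topspace Y" "y' \<in> topspace Y" for y y'
    using connected_space_locally_constant[OF assms(2), of "\<lambda>y. card (fibre X p y)"] that by blast
  then show ?thesis
    using fin False unfolding has_covering_degree_def by blast
qed

lemma covering_degree_unique:
  assumes "has_covering_degree X Y p d" "has_covering_degree X Y p d'" "topspace Y \<noteq> {}"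
  shows "d = d'"
  using assms unfolding has_covering_degree_def by auto

section \<open>Lifts through a covering from every starting point of a closed box\<close>

section \<open>Lifting maps defined on boxes\<close>

text \<open>The lift may be prescribed at any point of \<open>B\<close>, so that the property passes
  to subsets and no base point has to be carried through a subdivision.\<close>

definition lifts_on :: "'c topology \<Rightarrow> 'a topology \<Rightarrow> ('a \<Rightarrow> 'b) \<Rightarrow> ('c \<Rightarrow> 'b) \<Rightarrow> 'c set \<Rightarrow> bool" where
  "lifts_on T X p f B \<longleftrightarrow>
     (\<forall>x\<in>B. \<forall>z\<in>topspace X. p z = f x \<longrightarrow>
        (\<exists>g. continuous_map (subtopology T B) X g \<and> (\<forall>b\<in>B. p (g b) = f b) \<and> g x = z))"

lemma lifts_on_mono:
  assumes "lifts_on T X p f B" "A \<subseteq> B"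
  shows "lifts_on T X p f A"
  unfolding lifts_on_def
proof (intro ballI impI)
  fix x z assume "x \<in> A" "z \<in> topspace X" "p z = f x"
  then obtain g where "continuous_map (subtopology T B) X g" "\<forall>b\<in>B. p (g b) = f b" "g x = z"
    using assms unfolding lifts_on_def by blast
  then show "\<exists>g. continuous_map (subtopology T A) X g \<and> (\<forall>b\<in>A. p (g b) = f b) \<and> g x = z"
    using assms(2) continuous_map_from_subtopology_mono by blast
qed

text \<open>A lift on one half is continued by the lift on the other half that has the same value at
  \<open>w\<close>. On the connected wall \<open>r x = t\<close> the two agree by uniqueness, and
  they paste along closed sets.\<close>

lemma lifts_on_glue:
  fixes r :: "'c \<Rightarrow> real"
  assumes cov: "covering_map X Y p" and haus: "Hausdorff_space X"
    and r: "continuous_map T euclideanreal r" and B: "B \<subseteq> topspace T"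
    and low: "lifts_on T X p f {x \<in> B. r x \<le> t}" and up: "lifts_on T X p f {x \<in> B. t \<le> r x}"
    and conn: "connectedin T {x \<in> B. r x = t}" and w: "w \<in> B" "r w = t"
  shows "lifts_on T X p f B"
proof -
  \<comment> \<open>Here the starting point lies in the lower half. Stating this for arbitrary
    \<open>r\<close> and \<open>t\<close> lets the other case follow by passing to
    \<open>- r\<close> and \<open>- t\<close>.\<close>
  have *: "\<exists>g. continuous_map (subtopology T B) X g \<and> (\<forall>b\<in>B. p (g b) = f b) \<and> g x = z"
    if x: "x \<in> B" "r x \<le> t" and z: "z \<in> topspace X" "p z = f x"
      and r: "continuous_map T euclideanreal r"
      and low: "lifts_on T X p f {x \<in> B. r x \<le> t}" and up: "lifts_on T X p f {x \<in> B. t \<le> r x}"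
      and conn: "connectedin T {x \<in> B. r x = t}" and w: "r w = t"
    for x z t and r :: "'c \<Rightarrow> real"
  proof -
    obtain g1 where g1: "continuous_map (subtopology T {x \<in> B. r x \<le> t}) X g1"
      "\<And>b. b \<in> {x \<in> B. r x \<le> t} \<Longrightarrow> p (g1 b) = f b" "g1 x = z"
      using low x z unfolding lifts_on_def by (metis (mono_tags, lifting) mem_Collect_eq)
    have "g1 w \<in> topspace X"
      using w \<open>w \<in> B\<close> B by (intro continuous_map_image_subset_topspace[OF g1(1), THEN subsetD]) auto
    moreover have "p (g1 w) = f w"
      using g1(2) w \<open>w \<in> B\<close> by auto
    moreover have "w \<in> {x \<in> B. t \<le> r x}"
      using w \<open>w \<in> B\<close> by auto
    ultimately obtain g2 where g2: "continuous_map (subtopology T {x \<in> B. t \<le> r x}) X g2"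
      "\<And>b. b \<in> {x \<in> B. t \<le> r x} \<Longrightarrow> p (g2 b) = f b" "g2 w = g1 w"
      using up unfolding lifts_on_def by blast
    let ?C = "{x \<in> B. r x = t}"
    have topC: "topspace (subtopology T ?C) = ?C"
      using B by (auto simp: )
    have agree: "g1 y = g2 y" if y: "y \<in> B" "r y = t" for y
    proof (rule covering_map_unique_lift[OF cov haus, where T = "subtopology T ?C" and ?t0.0 = w])
      show "connected_space (subtopology T ?C)"
        using conn by (simp add: connectedin_def)
      show "continuous_map (subtopology T ?C) X g1"
        by (rule continuous_map_from_subtopology_mono[OF g1(1)]) auto
      show "continuous_map (subtopology T ?C) X g2"
        by (rule continuous_map_from_subtopology_mono[OF g2(1)]) auto
    qed (use topC g1(2) g2(2,3) w \<open>w \<in> B\<close> y in auto)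
    let ?g = "\<lambda>x. if r x \<le> t then g1 x else g2 x"
    have topB: "topspace (subtopology T B) = B"
      using B by auto
    have "continuous_map (subtopology T B) X ?g"
    proof (rule continuous_map_cases_le)
      show "continuous_map (subtopology T B) euclideanreal r"
        by (rule continuous_map_from_subtopology[OF r])
      show "continuous_map (subtopology T B) euclideanreal (\<lambda>_. t)"
        by simp
      have "subtopology (subtopology T B) {x. x \<in> topspace (subtopology T B) \<and> r x \<le> t}
          = subtopology T {x \<in> B. r x \<le> t}"
        unfolding topB subtopology_subtopology by (rule arg_cong[of _ _ "subtopology T"]) auto
      then show "continuous_map (subtopology (subtopology T B) {x. x \<in> topspace (subtopology T B) \<and> r x \<le> t}) X g1"
        using g1(1) by simp
      have "subtopology (subtopology T B) {x. x \<in> topspace (subtopology T B) \<and> t \<le> r x}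
          = subtopology T {x \<in> B. t \<le> r x}"
        unfolding topB subtopology_subtopology by (rule arg_cong[of _ _ "subtopology T"]) auto
      then show "continuous_map (subtopology (subtopology T B) {x. x \<in> topspace (subtopology T B) \<and> t \<le> r x}) X g2"
        using g2(1) by simp
    qed (use agree in auto)
    moreover have "\<forall>b\<in>B. p (?g b) = f b"
      using g1(2) g2(2) by auto
    moreover have "?g x = z"
      using g1(3) x by simp
    ultimately show ?thesis
      by blast
  qed
  show ?thesis
    unfolding lifts_on_def
  proof (intro ballI impI)
    fix x z assume x: "x \<in> B" and z: "z \<in> topspace X" "p z = f x"
    show "\<exists>g. continuous_map (subtopology T B) X g \<and> (\<forall>b\<in>B. p (g b) = f b) \<and> g x = z"
    proof (cases "r x \<le> t")
      case True
      then show ?thesis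
        using *[OF x _ z r low up conn w(2)] by simp
    next
      case False
      have "continuous_map T euclideanreal (\<lambda>x. - r x)"
        using r by (intro continuous_intros)
      then show ?thesis
        using *[where r = "\<lambda>x. - r x" and t = "- t", OF x _ z] False low up conn w(2) by auto
    qed
  qed
qed

text \<open>Only the finitely many coordinates below \<open>n\<close> vary, so one radius suffices
  for all of them.\<close>

lemma powertop_real_box_neighbourhood:
  fixes v :: "nat \<Rightarrow> real"
  assumes "openin (powertop_real UNIV) W" "v \<in> W"
  obtains \<delta> where "\<delta> > 0" "\<And>x. (\<And>i. i < n \<Longrightarrow> \<bar>x i - v i\<bar> \<le> \<delta>) \<Longrightarrow> (\<And>i. i \<ge> n \<Longrightarrow> x i = v i) \<Longrightarrow> x \<in> W"
proof -
  obtain U :: "nat \<Rightarrow> real set" where U: "v \<in> Pi\<^sub>E UNIV U" "\<And>i. open (U i)" "Pi\<^sub>E UNIV U \<subseteq> W"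
    using product_topology_open_contains_basis[OF assms] by (auto simp flip: open_openin)
  have "\<exists>e>0. \<forall>y::real. \<bar>y - v i\<bar> < e \<longrightarrow> y \<in> U i" for i
    using U(1,2) open_dist[of "U i"] by (auto simp: dist_real_def)
  then obtain e where e: "\<And>i. e i > 0" "\<And>i y. \<bar>y - v i\<bar> < e i \<Longrightarrow> y \<in> U i"
    by metis
  \<comment> \<open>The entry \<open>1\<close> keeps the minimum meaningful for
    \<open>n = 0\<close>; halving gives strict inequality, so that closed intervals of radius
    \<delta> fit.\<close>
  define \<delta> where "\<delta> = Min (insert 1 (e ` {..<n})) / 2"
  have pos: "Min (insert 1 (e ` {..<n})) > 0"
    using e(1) by (subst Min_gr_iff) auto
  have lt: "\<delta> < e i" if "i < n" for i
  proof -
    have "Min (insert 1 (e ` {..<n})) \<le> e i"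
      using that by (intro Min_le) auto
    then show ?thesis
      using pos unfolding \<delta>_def by linarith
  qed
  show thesis
  proof (rule that)
    show "\<delta> > 0" using pos by (simp add: \<delta>_def)
    fix x assume x: "\<And>i. i < n \<Longrightarrow> \<bar>x i - v i\<bar> \<le> \<delta>" "\<And>i. i \<ge> n \<Longrightarrow> x i = v i"
    have "x i \<in> U i" for i
    proof (cases "i < n")
      case True
      then show ?thesis using x(1)[OF True] lt[OF True] by (intro e(2)) auto
    next
      case False
      then show ?thesis using x(2)[of i] U(1) by (auto simp: PiE_iff)
    qed
    then show "x \<in> W" using U(3) by auto
  qed
qed

text \<open>One coordinate is relaxed at a time, by the bisection argument of Bolzano. Two adjacent slabs meet
  in a box, which is connected, so their lifts can be glued by uniqueness.\<close>

lemma box_lifts_on: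
  fixes a b :: "nat \<Rightarrow> real" and f :: "(nat \<Rightarrow> real) \<Rightarrow> 'b"
  defines "Q \<equiv> Pi\<^sub>E UNIV (\<lambda>i. {a i..b i})"
  assumes cov: "covering_map X Y p" and haus: "Hausdorff_space X"
    and ab: "\<And>i. i \<ge> n \<Longrightarrow> a i = b i"
    and f: "continuous_map (subtopology (powertop_real UNIV) Q) Y f"
  shows "lifts_on (powertop_real UNIV) X p f Q"
proof -
  let ?T = "powertop_real (UNIV :: nat set)"
  let ?P = "lifts_on ?T X p f"
  have Q: "x \<in> Q \<longleftrightarrow> (\<forall>i. a i \<le> x i \<and> x i \<le> b i)" for x
    by (auto simp: Q_def PiE_iff)
  \<comment> \<open>Coordinates below \<open>k\<close> run through all of \<open>Q\<close>, those
    from \<open>k\<close> to \<open>n - 1\<close> stay near \<open>v\<close>. Thus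
    \<open>k = 0\<close> gives a small box and \<open>k = n\<close> gives \<open>Q\<close>; the
    induction on \<open>k\<close> produces a radius for which lifts exist.\<close>
  define slab where "slab k v \<delta> = {x \<in> Q. \<forall>i. k \<le> i \<longrightarrow> i < n \<longrightarrow> \<bar>x i - v i\<bar> \<le> \<delta>}" for k v \<delta>
  have slab_mono: "slab k v \<delta> \<subseteq> slab k v \<epsilon>" if "\<delta> \<le> \<epsilon>" for k v \<delta> \<epsilon>
    using that by (force simp: slab_def)
  have "\<exists>\<delta>>0. ?P (slab k v \<delta>)" if "k \<le> n" "v \<in> Q" for k v
    using that
  proof (induction k arbitrary: v)
    case 0
    have "f v \<in> topspace Y"
      using 0 by (intro continuous_map_image_subset_topspace[OF f, THEN subsetD]) auto
    then obtain V where V: "openin Y V" "f v \<in> V"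
      and sec: "\<And>z. z \<in> topspace X \<Longrightarrow> p z \<in> V \<Longrightarrow>
        \<exists>g. continuous_map (subtopology Y V) X g \<and> (\<forall>v\<in>V. p (g v) = v) \<and> g (p z) = z"
      using covering_map_local_section[OF cov] by metis
    have "openin (subtopology ?T Q) {x \<in> topspace (subtopology ?T Q). f x \<in> V}"
      by (rule openin_continuous_map_preimage[OF f V(1)])
    then obtain W where W: "openin ?T W" "{x \<in> topspace (subtopology ?T Q). f x \<in> V} = W \<inter> Q"
      unfolding openin_subtopology by (elim exE conjE)
    then have "v \<in> W" using V(2) 0(2) by auto
    from powertop_real_box_neighbourhood[OF W(1) this]
    obtain \<delta> where \<delta>: "\<delta> > 0"
        "\<And>x. (\<And>i. i < n \<Longrightarrow> \<bar>x i - v i\<bar> \<le> \<delta>) \<Longrightarrow> (\<And>i. i \<ge> n \<Longrightarrow> x i = v i) \<Longrightarrow> x \<in> W"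
      by metis
    have sub: "f x \<in> V" if x: "x \<in> slab 0 v \<delta>" for x
    proof -
      have "x i = v i" if "i \<ge> n" for i
        using ab[OF that] x \<open>v \<in> Q\<close> unfolding slab_def Q by (metis (mono_tags, lifting) Q mem_Collect_eq order_antisym)
      then have "x \<in> W" using x by (intro \<delta>(2)) (auto simp: slab_def)
      then have "x \<in> W \<inter> Q" using x by (simp add: slab_def)
      then show ?thesis using W(2) by blast
    qed
    have fc: "continuous_map (subtopology ?T (slab 0 v \<delta>)) (subtopology Y V) f"
      unfolding continuous_map_in_subtopology
    proof
      show "continuous_map (subtopology ?T (slab 0 v \<delta>)) Y f"
        by (rule continuous_map_from_subtopology_mono[OF f]) (auto simp: slab_def)
      show "f \<in> topspace (subtopology ?T (slab 0 v \<delta>)) \<rightarrow> V"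
        using sub by auto
    qed
    have "?P (slab 0 v \<delta>)"
      unfolding lifts_on_def
    proof (intro ballI impI)
      fix x z assume x: "x \<in> slab 0 v \<delta>" and z: "z \<in> topspace X" "p z = f x"
      then obtain g where g: "continuous_map (subtopology Y V) X g" "\<forall>v\<in>V. p (g v) = v" "g (p z) = z"
        using sec[of z] sub[OF x] by auto
      show "\<exists>g. continuous_map (subtopology ?T (slab 0 v \<delta>)) X g \<and> (\<forall>b\<in>slab 0 v \<delta>. p (g b) = f b) \<and> g x = z"
        using continuous_map_compose[OF fc g(1)] g(2,3) sub z(2) by (intro exI[of _ "g \<circ> f"]) auto
    qed
    then show ?case using \<delta>(1) by blast
  next
    case (Suc k)
    then have k: "k < n" by simp
    \<comment> \<open>The interval statement that is bisected: lifts exist when coordinate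
      \<open>k\<close> is confined to \<open>{s..t}\<close>, with a radius depending on that
      interval. Gluing two intervals takes the smaller radius.\<close>
    define R where "R s t \<longleftrightarrow> a k \<le> s \<longrightarrow> t \<le> b k \<longrightarrow>
      (\<exists>\<delta>>0. ?P {x \<in> slab (Suc k) v \<delta>. s \<le> x k \<and> x k \<le> t})" for s t
    have "R (a k) (b k)"
    proof (rule Bolzano[of "a k" "b k" R])
      show "a k \<le> b k" using Suc.prems(2) Q order_trans by blast
    next
      fix s t u assume R: "R s t" "R t u" and st: "s \<le> t" "t \<le> u"
      show "R s u"
        unfolding R_def
      proof (intro impI)
        assume su: "a k \<le> s" "u \<le> b k"
        obtain \<delta> \<epsilon> where d: "\<delta> > 0" "?P {x \<in> slab (Suc k) v \<delta>. s \<le> x k \<and> x k \<le> t}"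
          "\<epsilon> > 0" "?P {x \<in> slab (Suc k) v \<epsilon>. t \<le> x k \<and> x k \<le> u}"
          using R su st unfolding R_def by (meson order_trans)
        define \<eta> where "\<eta> = min \<delta> \<epsilon>"
        have \<eta>: "\<eta> > 0" "\<eta> \<le> \<delta>" "\<eta> \<le> \<epsilon>" using d by (auto simp: \<eta>_def)
        let ?B = "{x \<in> slab (Suc k) v \<eta>. s \<le> x k \<and> x k \<le> u}"
        let ?w = "v(k := t)"
        have "?P ?B"
        proof (rule lifts_on_glue[OF cov haus, where r = "\<lambda>x. x k" and t = t and w = ?w])
          show "continuous_map ?T euclideanreal (\<lambda>x. x k)"
            using continuous_map_product_projection[of k UNIV "\<lambda>_. euclideanreal"] by simp
          show "?B \<subseteq> topspace ?T" by simp
          show "?P {x \<in> ?B. x k \<le> t}"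
            using slab_mono[OF \<eta>(2)] by (intro lifts_on_mono[OF d(2)]) auto
          show "?P {x \<in> ?B. t \<le> x k}"
            using slab_mono[OF \<eta>(3)] by (intro lifts_on_mono[OF d(4)]) auto
          show "?w \<in> ?B" "?w k = t"
            using Suc.prems(2) su st \<eta>(1) unfolding slab_def by (auto simp: Q)
          have "{x \<in> ?B. x k = t} = Pi\<^sub>E UNIV (\<lambda>i. if i = k then {t} else
              if k < i \<and> i < n then {max (a i) (v i - \<eta>)..min (b i) (v i + \<eta>)} else {a i..b i})"
            (is "_ = Pi\<^sub>E UNIV ?I")
          proof (intro equalityI subsetI)
            fix x assume x: "x \<in> {x \<in> ?B. x k = t}"
            have "v i - \<eta> \<le> x i \<and> x i \<le> v i + \<eta>" if "k < i" "i < n" for i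
            proof -
              have "\<bar>x i - v i\<bar> \<le> \<eta>" using x that by (simp add: slab_def)
              then show ?thesis by linarith
            qed
            then have "x i \<in> ?I i" for i
              using x by (auto simp: slab_def Q)
            then show "x \<in> Pi\<^sub>E UNIV ?I" by (simp add: PiE_iff)
          next
            fix x assume "x \<in> Pi\<^sub>E UNIV ?I"
            then have x: "x i \<in> ?I i" for i by (auto simp: PiE_iff)
            have "a i \<le> x i \<and> x i \<le> b i" for i
              using x[of i] su st by (auto split: if_splits)
            moreover have "\<bar>x i - v i\<bar> \<le> \<eta>" if "Suc k \<le> i" "i < n" for i
              using x[of i] that by (auto split: if_splits)
            ultimately show "x \<in> {x \<in> ?B. x k = t}"
              using x[of k] st by (auto simp: slab_def Q)
          qed
          moreover have "connectedin ?T (Pi\<^sub>E UNIV ?I)"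
            unfolding connectedin_PiE by auto
          ultimately show "connectedin ?T {x \<in> ?B. x k = t}" by simp
        qed
        then show "\<exists>\<delta>>0. ?P {x \<in> slab (Suc k) v \<delta>. s \<le> x k \<and> x k \<le> u}"
          using \<eta>(1) by blast
      qed
    next
      \<comment> \<open>The induction hypothesis at \<open>v(k := x)\<close> also restricts
        coordinate \<open>k\<close>; an interval around \<open>x\<close> shorter than its radius
        \<delta> stays inside that slab.\<close>
      fix x assume x: "a k \<le> x" "x \<le> b k"
      have "v(k := x) \<in> Q" using Suc.prems(2) x by (auto simp: Q)
      then obtain \<delta> where \<delta>: "\<delta> > 0" "?P (slab k (v(k := x)) \<delta>)"
        using Suc.IH k by (meson less_imp_le)
      have "R s t" if st: "s \<le> x" "x \<le> t" "t - s < \<delta>" for s t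
      proof -
        have "{y \<in> slab (Suc k) v \<delta>. s \<le> y k \<and> y k \<le> t} \<subseteq> slab k (v(k := x)) \<delta>"
        proof
          fix y assume y: "y \<in> {y \<in> slab (Suc k) v \<delta>. s \<le> y k \<and> y k \<le> t}"
          have "\<bar>y i - (v(k := x)) i\<bar> \<le> \<delta>" if "k \<le> i" "i < n" for i
          proof (cases "i = k")
            case True
            then show ?thesis using y st by auto
          next
            case False
            then show ?thesis using y that by (auto simp: slab_def)
          qed
          then show "y \<in> slab k (v(k := x)) \<delta>" using y by (auto simp: slab_def)
        qed
        then show ?thesis
          unfolding R_def using \<delta> lifts_on_mono by blast
      qed
      then show "\<exists>d>0. \<forall>a b. a \<le> x \<and> x \<le> b \<and> b - a < d \<longrightarrow> R a b"
        using \<delta>(1) by blast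
    qed
    then obtain \<delta> where "\<delta> > 0" "?P {x \<in> slab (Suc k) v \<delta>. a k \<le> x k \<and> x k \<le> b k}"
      unfolding R_def by blast
    moreover have "{x \<in> slab (Suc k) v \<delta>. a k \<le> x k \<and> x k \<le> b k} = slab (Suc k) v \<delta>"
      by (auto simp: slab_def Q)
    ultimately show ?case by auto
  qed
  from this[of n] have "v \<in> Q \<Longrightarrow> \<exists>\<delta>>0. ?P (slab n v \<delta>)" for v by simp
  moreover have "slab n v \<delta> = Q" for v \<delta> by (auto simp: slab_def)
  ultimately have "v \<in> Q \<Longrightarrow> ?P Q" for v by auto
  then show ?thesis by (auto simp: lifts_on_def)
qed

section \<open>Star refinements, followed by the local product structure of a solenoid\<close>

section \<open>Plaques and tubes of a solenoid\<close>

text \<open>Regularity and compactness give finitely many triples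
  \<open>O' \<subseteq> C \<subseteq> V\<close> whose open sets \<open>O'\<close> cover
  \<open>X\<close>. For each of them \<open>W x\<close> is cut down to \<open>V\<close> if
  \<open>x \<in> C\<close>, and to the complement of \<open>C\<close> otherwise. A common point of
  \<open>W x\<close> and \<open>W y\<close> lies in some \<open>O'\<close>; this forces both
  \<open>x\<close> and \<open>y\<close> into its \<open>C\<close>, hence both sets into its
  \<open>V\<close>.\<close>

lemma compact_Hausdorff_star_refinement:
  assumes comp: "compact_space X" and haus: "Hausdorff_space X"
    and op: "\<And>V. V \<in> \<V> \<Longrightarrow> openin X V" and cover: "topspace X \<subseteq> \<Union>\<V>"
  obtains W where "\<forall>x\<in>topspace X. openin X (W x) \<and> x \<in> W x"
    "\<forall>x y. W x \<inter> W y \<noteq> {} \<longrightarrow> (\<exists>V\<in>\<V>. W x \<union> W y \<subseteq> V)"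
proof -
  have "neighbourhood_base_of (closedin X) X"
    using compact_Hausdorff_imp_regular_space[OF comp haus] neighbourhood_base_of_closedin by blast
  then have shrink: "\<exists>O' C V. openin X O' \<and> closedin X C \<and> x \<in> O' \<and> O' \<subseteq> C \<and> C \<subseteq> V \<and> V \<in> \<V>"
    if "x \<in> topspace X" for x
    using that op cover unfolding neighbourhood_base_of by (metis Union_iff subsetD)
  define P where "P = {(O', C, V). openin X O' \<and> closedin X C \<and> O' \<subseteq> C \<and> C \<subseteq> V \<and> V \<in> \<V>}"
  have "topspace X \<subseteq> \<Union> (fst ` P)"
  proof
    fix x assume "x \<in> topspace X"
    from shrink[OF this] obtain O' C V where "(O', C, V) \<in> P" "x \<in> O'"
      unfolding P_def by blast
    then show "x \<in> \<Union> (fst ` P)" by (metis UnionI fst_conv image_eqI)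
  qed
  moreover have "\<And>U. U \<in> fst ` P \<Longrightarrow> openin X U" by (auto simp: P_def)
  ultimately obtain \<F> where "finite \<F>" "\<F> \<subseteq> fst ` P" "topspace X \<subseteq> \<Union>\<F>"
    using comp unfolding compact_space_alt by meson
  then obtain Q where Q: "Q \<subseteq> P" "finite Q" "\<F> = fst ` Q"
    by (meson finite_subset_image)
  define N where "N r x = (if x \<in> fst (snd r) then snd (snd r) else topspace X - fst (snd r))"
    for r :: "'a set \<times> 'a set \<times> 'a set" and x
  define W where "W x = topspace X \<inter> \<Inter> ((\<lambda>r. N r x) ` Q)" for x
  show thesis
  proof (rule that; intro ballI allI impI)
    fix x assume x: "x \<in> topspace X"
    have "openin X (N r x)" if "r \<in> Q" for r
    proof -
      have "closedin X (fst (snd r))" "openin X (snd (snd r))"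
        using that Q(1) op unfolding P_def by auto
      then show ?thesis by (simp add: N_def openin_diff)
    qed
    then have "openin X (W x)"
      unfolding W_def using Q(2) by (intro openin_Int_Inter) auto
    moreover have "x \<in> N r x" if "r \<in> Q" for r
    proof -
      have "fst (snd r) \<subseteq> snd (snd r)"
        using that Q(1) unfolding P_def by (cases r) auto
      then show ?thesis using x by (auto simp: N_def)
    qed
    then have "x \<in> W x" using x by (simp add: W_def)
    ultimately show "openin X (W x) \<and> x \<in> W x" by blast
  next
    fix x y assume "W x \<inter> W y \<noteq> {}"
    then obtain z where z: "z \<in> W x" "z \<in> W y" by blast
    then have "z \<in> topspace X" by (simp add: W_def)
    then obtain r where r: "r \<in> Q" "z \<in> fst r"
      using \<open>topspace X \<subseteq> \<Union>\<F>\<close> Q(3) by blast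
    then have rP: "fst r \<subseteq> fst (snd r)" "snd (snd r) \<in> \<V>"
      using Q(1) unfolding P_def by (cases r, force)+
    have "W u \<subseteq> snd (snd r)" if "z \<in> W u" for u
    proof -
      have sub: "W u \<subseteq> N r u" using r(1) by (auto simp: W_def)
      then have "u \<in> fst (snd r)"
        using that r(2) rP(1) unfolding N_def by (auto split: if_splits)
      then show ?thesis using sub by (simp add: N_def)
    qed
    then show "\<exists>V\<in>\<V>. W x \<union> W y \<subseteq> V" using z rP(2) by blast
  qed
qed

section \<open>The inverse limit: points, compactness, and a basis of its topology\<close>

locale solenoid =
  fixes n :: nat and M :: "nat \<Rightarrow> 'a topology" and q :: "nat \<Rightarrow> 'a \<Rightarrow> 'a"
  assumes pres: "presentation n M q"
begin

abbreviation S where "S \<equiv> solenoidal_manifold M q"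

lemma nonempty_M: "topspace (M l) \<noteq> {}"
  and compact_M: "compact_space (M l)"
  and connected_M: "connected_space (M l)"
  and Hausdorff_M: "Hausdorff_space (M l)"
  and Euclidean_M: "locally_Euclidean_space n (M l)"
  using pres by (auto simp: presentation_def manifold_without_boundary_def)

lemma finite_covering_q: "finite_covering_map (M (Suc l)) (M l) (q (Suc l))"
  using conjunct2[OF pres[unfolded presentation_def], rule_format, of "Suc l"]
  by (simp add: proper_finite_covering_map_def)

lemma covering_q: "covering_map (M (Suc l)) (M l) (q (Suc l))"
  using finite_covering_q by (simp add: finite_covering_map_def)

lemma continuous_q: "continuous_map (M (Suc l)) (M l) (q (Suc l))"
  by (rule covering_map_continuous[OF covering_q])

lemma in_S_iff:
  "s \<in> topspace S \<longleftrightarrow> (\<forall>l. s l \<in> topspace (M l)) \<and> (\<forall>l. q (Suc l) (s (Suc l)) = s l)"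
proof -
  have "(\<forall>l\<ge>1. q l (s l) = s (l - 1)) \<longleftrightarrow> (\<forall>l. q (Suc l) (s (Suc l)) = s l)"
    by (metis Suc_le_D diff_Suc_1 le_add1 plus_1_eq_Suc One_nat_def)
  then show ?thesis
    by (auto simp: solenoidal_manifold_def PiE_iff)
qed

lemma S_coordinate: "s \<in> topspace S \<Longrightarrow> s l \<in> topspace (M l)"
  by (simp add: in_S_iff)

lemma S_step: "s \<in> topspace S \<Longrightarrow> q (Suc l) (s (Suc l)) = s l"
  by (simp add: in_S_iff)

lemma continuous_coordinate: "continuous_map S (M l) (\<lambda>s. s l)"
  unfolding solenoidal_manifold_def
  by (intro continuous_map_from_subtopology continuous_map_product_projection) simp

lemma continuous_into_S:
  assumes "\<And>l. continuous_map T (M l) (\<lambda>t. f t l)" "\<And>t. t \<in> topspace T \<Longrightarrow> f t \<in> topspace S"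
  shows "continuous_map T S f"
  unfolding solenoidal_manifold_def continuous_map_in_subtopology
proof
  show "continuous_map T (product_topology M UNIV) f"
    using assms(1) by (simp add: continuous_map_componentwise_UNIV)
  show "f \<in> topspace T \<rightarrow> {x. \<forall>l\<ge>1. q l (x l) = x (l - 1)}"
    using assms(2) by (auto simp: solenoidal_manifold_def)
qed

lemma continuous_coordinate_of:
  assumes "continuous_map T S f"
  shows "continuous_map T (M l) (\<lambda>t. f t l)"
  using continuous_map_compose[OF assms continuous_coordinate] by (simp add: o_def)

lemma coordinate_eq_below:
  assumes "s \<in> topspace S" "t \<in> topspace S" "s c = t c" "l \<le> c"
  shows "s l = t l"
  using assms(4,3)
proof (induction rule: dec_induct)
  case (step c)
  then show ?case using S_step assms(1,2) by metis
qed

text \<open>Coordinates below \<open>l\<close> are the images of \<open>y\<close>; those above are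
  chosen one after another by surjectivity of the bonding maps.\<close>

lemma S_surj:
  assumes "y \<in> topspace (M l)"
  obtains s where "s \<in> topspace S" "s l = y"
proof -
  have "\<exists>f. f l = y \<and> (\<forall>i\<le>l. f i \<in> topspace (M i)) \<and> (\<forall>i<l. q (Suc i) (f (Suc i)) = f i)"
    using assms
  proof (induction l arbitrary: y)
    case 0
    then show ?case by (intro exI[of _ "\<lambda>_. y"]) simp
  next
    case (Suc l)
    have "q (Suc l) y \<in> topspace (M l)"
      using Suc.prems continuous_map_image_subset_topspace[OF continuous_q] by blast
    from Suc.IH[OF this] obtain f where f: "f l = q (Suc l) y"
      "\<And>i. i \<le> l \<Longrightarrow> f i \<in> topspace (M i)" "\<And>i. i < l \<Longrightarrow> q (Suc i) (f (Suc i)) = f i"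
      by blast
    show ?case
    proof (intro exI[of _ "f(Suc l := y)"] conjI allI impI)
      fix i assume "i < Suc l"
      then show "q (Suc i) ((f(Suc l := y)) (Suc i)) = (f(Suc l := y)) i"
        using f by (cases "i = l") auto
    qed (use f(2) Suc.prems in \<open>auto simp: le_Suc_eq\<close>)
  qed
  then obtain f where f: "f l = y" "\<And>i. i \<le> l \<Longrightarrow> f i \<in> topspace (M i)"
    "\<And>i. i < l \<Longrightarrow> q (Suc i) (f (Suc i)) = f i"
    by blast
  let ?P = "\<lambda>j x. x \<in> topspace (M j) \<and> (j \<le> l \<longrightarrow> x = f j)"
  have "\<exists>s. \<forall>j. ?P j (s j) \<and> q (Suc j) (s (Suc j)) = s j"
  proof (rule dependent_nat_choice)
    show "\<exists>x. ?P 0 x" using f by auto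
    fix x j assume x: "?P j x"
    show "\<exists>z. ?P (Suc j) z \<and> q (Suc j) z = x"
    proof (cases "Suc j \<le> l")
      case True
      then show ?thesis using x f(2,3) by auto
    next
      case False
      have "x \<in> q (Suc j) ` topspace (M (Suc j))"
        using covering_q[of j] x by (simp add: covering_map_def)
      then show ?thesis using False by auto
    qed
  qed
  then obtain s where "\<And>j. ?P j (s j)" "\<And>j. q (Suc j) (s (Suc j)) = s j"
    by blast
  then show thesis using f(1) by (intro that[of s]) (auto simp: in_S_iff)
qed

text \<open>The compatibility conditions are equalizers of continuous maps into Hausdorff spaces,
  hence closed in a compact product.\<close>

lemma compact_S: "compact_space S"
proof -
  let ?X = "product_topology M UNIV"
  have "closedin ?X {x \<in> topspace ?X. q (Suc l) (x (Suc l)) = x l}" for l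
  proof (rule closedin_continuous_maps_eq[OF Hausdorff_M])
    show "continuous_map ?X (M l) (\<lambda>x. x l)"
      by (rule continuous_map_product_projection) simp
    have "continuous_map ?X (M (Suc l)) (\<lambda>x. x (Suc l))"
      by (rule continuous_map_product_projection) simp
    from continuous_map_compose[OF this continuous_q]
    show "continuous_map ?X (M l) (\<lambda>x. q (Suc l) (x (Suc l)))"
      by (simp add: o_def)
  qed
  then have "closedin ?X (\<Inter>l. {x \<in> topspace ?X. q (Suc l) (x (Suc l)) = x l})"
    by (intro closedin_Inter) auto
  also have "(\<Inter>l. {x \<in> topspace ?X. q (Suc l) (x (Suc l)) = x l}) = topspace S"
    by (auto simp: in_S_iff PiE_iff)
  finally have "closedin ?X (topspace S)" .
  moreover have "compact_space ?X"
    using compact_space_product_topology compact_M by blast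
  ultimately have "compactin ?X (topspace S)"
    by (metis closedin_compact_space)
  then have "compact_space (subtopology ?X (topspace S))"
    by (rule compact_space_subtopology)
  moreover have "subtopology ?X (topspace S) = S"
    unfolding solenoidal_manifold_def
    by (metis inf.absorb_iff2 subtopology_restrict topspace_subtopology topspace_subtopology_subset)
  ultimately show ?thesis by simp
qed

lemma open_pullback:
  assumes "openin (M l) U" "l \<le> c"
  shows "\<exists>Z. openin (M c) Z \<and> (\<forall>s\<in>topspace S. s c \<in> Z \<longleftrightarrow> s l \<in> U)"
  using assms(2)
proof (induction rule: dec_induct)
  case base
  then show ?case using assms(1) by blast
next
  case (step c)
  then obtain Z where Z: "openin (M c) Z" "\<forall>s\<in>topspace S. s c \<in> Z \<longleftrightarrow> s l \<in> U"
    by blast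
  let ?Z = "{x \<in> topspace (M (Suc c)). q (Suc c) x \<in> Z}"
  have "openin (M (Suc c)) ?Z"
    by (rule openin_continuous_map_preimage[OF continuous_q Z(1)])
  moreover have "\<forall>s\<in>topspace S. s (Suc c) \<in> ?Z \<longleftrightarrow> s l \<in> U"
    using Z(2) by (auto simp: in_S_iff)
  ultimately show ?case by blast
qed

text \<open>A basic open set of the product restricts finitely many coordinates. Pulled back along
  the bonding maps, these restrictions become a single one at a common level, which can be taken to
  be at least \<open>d\<close>.\<close>

lemma S_basis:
  assumes "openin S W" "s \<in> W"
  obtains c Z where "d \<le> c" "openin (M c) Z" "s c \<in> Z" "\<forall>t\<in>topspace S. t c \<in> Z \<longrightarrow> t \<in> W"
proof -
  obtain W' where W': "openin (product_topology M UNIV) W'"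
    "W = W' \<inter> {x. \<forall>l\<ge>1. q l (x l) = x (l - 1)}"
    using assms(1) unfolding solenoidal_manifold_def openin_subtopology by blast
  have s: "s \<in> topspace S"
    using assms openin_subset by blast
  from W' assms(2) have "s \<in> W'" by blast
  from product_topology_open_contains_basis[OF W'(1) this]
  obtain U where U: "s \<in> Pi\<^sub>E UNIV U" "\<And>i. openin (M i) (U i)"
    "finite {i. U i \<noteq> topspace (M i)}" "Pi\<^sub>E UNIV U \<subseteq> W'"
    by blast
  define F where "F = {i. U i \<noteq> topspace (M i)}"
  have F: "finite F" "\<And>i. i \<notin> F \<Longrightarrow> U i = topspace (M i)"
    using U(3) by (simp_all add: F_def)
  define c where "c = Max (insert d F)"
  have fin: "finite (insert d F)" using F(1) by (rule finite.insertI)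
  have c: "d \<le> c"
    unfolding c_def by (rule Max_ge[OF fin insertI1])
  have "i \<le> c" if "i \<in> F" for i
    unfolding c_def by (rule Max_ge[OF fin insertI2[OF that]])
  then have "\<forall>i\<in>F. \<exists>Z. openin (M c) Z \<and> (\<forall>s\<in>topspace S. s c \<in> Z \<longleftrightarrow> s i \<in> U i)"
    by (intro ballI open_pullback[OF U(2)])
  then obtain Z where Z: "\<forall>i\<in>F. openin (M c) (Z i) \<and> (\<forall>s\<in>topspace S. s c \<in> Z i \<longleftrightarrow> s i \<in> U i)"
    by (rule bchoice[THEN exE])
  let ?Z = "topspace (M c) \<inter> \<Inter> (Z ` F)"
  show thesis
  proof (rule that[OF c])
    show "openin (M c) ?Z"
      using F(1) Z by (intro openin_Int_Inter) auto
    show "s c \<in> ?Z"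
      using s S_coordinate Z U(1) by (auto simp: PiE_iff)
    show "\<forall>t\<in>topspace S. t c \<in> ?Z \<longrightarrow> t \<in> W"
    proof (intro ballI impI)
      fix t assume t: "t \<in> topspace S" "t c \<in> ?Z"
      have "t i \<in> U i" for i
      proof (cases "i \<in> F")
        case True
        then show ?thesis using Z t by blast
      next
        case False
        then show ?thesis using F(2) S_coordinate[OF t(1)] by simp
      qed
      then have "t \<in> W'" using U(4) by (auto simp: PiE_iff)
      moreover have "t \<in> {x. \<forall>l\<ge>1. q l (x l) = x (l - 1)}"
        using t(1) by (auto simp: solenoidal_manifold_def)
      ultimately show "t \<in> W" using W'(2) by blast
    qed
  qed
qed

text \<open>Unique lifting, one level at a time. Agreement is asked only up to level
  \<open>l\<close>, which makes it possible to compare plaques that coincide at a finite level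
  without being equal.\<close>

lemma agree_at_level:
  assumes T: "connected_space T" and f: "continuous_map T S f" and g: "continuous_map T S g"
    and 0: "\<And>t. t \<in> topspace T \<Longrightarrow> f t 0 = g t 0"
    and t0: "t0 \<in> topspace T" "f t0 l = g t0 l" and t: "t \<in> topspace T"
  shows "f t l = g t l"
  using t0(2) t
proof (induction l arbitrary: t)
  case 0
  then show ?case using assms(4) by simp
next
  case (Suc l)
  have S: "f t \<in> topspace S" "g t \<in> topspace S" if "t \<in> topspace T" for t
    using f g that continuous_map_image_subset_topspace by blast+
  have "f t0 l = g t0 l"
    using S[OF t0(1)] Suc.prems(1) S_step by metis
  then have IH: "f t l = g t l" if "t \<in> topspace T" for t
    using Suc.IH that by blast
  show ?case
  proof (rule covering_map_unique_lift[OF covering_q Hausdorff_M T, where ?t0.0 = t0 and f = "\<lambda>t. f t (Suc l)"])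
    show "continuous_map T (M (Suc l)) (\<lambda>t. f t (Suc l))" "continuous_map T (M (Suc l)) (\<lambda>t. g t (Suc l))"
      using f g by (auto intro: continuous_coordinate_of)
    show "q (Suc l) (f t (Suc l)) = q (Suc l) (g t (Suc l))" if "t \<in> topspace T" for t
      using IH[OF that] S[OF that] S_step by simp
  qed (use t0 Suc.prems in auto)
qed

section \<open>Subsets of the base over which the solenoid splits into sections\<close>

text \<open>Over a trivializing set the solenoid is a union of plaques, the images of the sections.\<close>

definition trivializing :: "'a set \<Rightarrow> bool" where
  "trivializing V \<longleftrightarrow> openin (M 0) V \<and> connectedin (M 0) V \<and>
     (\<forall>s\<in>topspace S. s 0 \<in> V \<longrightarrow>
        (\<exists>\<sigma>. continuous_map (subtopology (M 0) V) S \<sigma> \<and> (\<forall>v\<in>V. \<sigma> v 0 = v) \<and> \<sigma> (s 0) = s))"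

text \<open>The map is lifted through the bonding maps successively, the lift to level
  \<open>l\<close> being the one that takes the value \<open>s l\<close> at
  \<open>x\<close>.\<close>

lemma box_lifts_to_S:
  fixes a b :: "nat \<Rightarrow> real"
  defines "Q \<equiv> Pi\<^sub>E UNIV (\<lambda>i. {a i..b i})"
  assumes ab: "\<And>i. i \<ge> n \<Longrightarrow> a i = b i"
    and f: "continuous_map (subtopology (powertop_real UNIV) Q) (M 0) f"
    and x: "x \<in> Q" and s: "s \<in> topspace S" "s 0 = f x"
  shows "\<exists>\<sigma>. continuous_map (subtopology (powertop_real UNIV) Q) S \<sigma> \<and> (\<forall>y\<in>Q. \<sigma> y 0 = f y) \<and> \<sigma> x = s"
proof -
  let ?T = "subtopology (powertop_real (UNIV :: nat set)) Q"
  let ?P = "\<lambda>l g. continuous_map ?T (M l) g \<and> g x = s l \<and> (l = 0 \<longrightarrow> g = f)"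
  have "\<exists>g. \<forall>l. ?P l (g l) \<and> (\<forall>y\<in>Q. q (Suc l) (g (Suc l) y) = g l y)"
  proof (rule dependent_nat_choice)
    show "\<exists>g. ?P 0 g" using f s(2) by auto
    fix g l assume g: "?P l g"
    then have "lifts_on (powertop_real UNIV) (M (Suc l)) (q (Suc l)) g Q"
      using box_lifts_on[OF covering_q Hausdorff_M, where n = n] ab unfolding Q_def by blast
    moreover have "q (Suc l) (s (Suc l)) = g x"
      using g S_step[OF s(1)] by simp
    ultimately show "\<exists>h. ?P (Suc l) h \<and> (\<forall>y\<in>Q. q (Suc l) (h y) = g y)"
      using x S_coordinate[OF s(1)] unfolding lifts_on_def by blast
  qed
  then obtain g where g: "\<And>l. ?P l (g l)" "\<And>l y. y \<in> Q \<Longrightarrow> q (Suc l) (g (Suc l) y) = g l y"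
    by metis
  let ?\<sigma> = "\<lambda>y l. g l y"
  have "continuous_map ?T S ?\<sigma>"
  proof (rule continuous_into_S)
    show "continuous_map ?T (M l) (\<lambda>y. g l y)" for l
      using g(1) by blast
    fix y assume y: "y \<in> topspace ?T"
    then have "g l y \<in> topspace (M l)" for l
      using g(1) continuous_map_image_subset_topspace by blast
    then show "?\<sigma> y \<in> topspace S"
      using g(2) y by (simp add: in_S_iff)
  qed
  moreover have "\<forall>y\<in>Q. ?\<sigma> y 0 = f y" using g(1)[of 0] by simp
  moreover have "?\<sigma> x = s" using g(1) by auto
  ultimately show ?thesis by (intro exI[of _ ?\<sigma>]) blast
qed

text \<open>A closed box in a chart admits lifts through every point. Its open part is both open and
  connected, and the lifts restrict to it.\<close>

lemma trivializing_basis: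
  assumes "openin (M 0) W" "x \<in> W"
  obtains V where "trivializing V" "x \<in> V" "V \<subseteq> W"
proof -
  let ?E = "Euclidean_space n"
  let ?R = "powertop_real (UNIV :: nat set)"
  have "x \<in> topspace (M 0)" using assms openin_subset by blast
  then obtain U A where U: "openin (M 0) U" "x \<in> U" "openin ?E A"
    "subtopology (M 0) U homeomorphic_space subtopology ?E A"
    using Euclidean_M[of 0] unfolding locally_Euclidean_space_def by blast
  then obtain \<alpha> \<beta> where "homeomorphic_maps (subtopology (M 0) U) (subtopology ?E A) \<alpha> \<beta>"
    unfolding homeomorphic_space_def by blast
  moreover have topU: "topspace (subtopology (M 0) U) = U" "topspace (subtopology ?E A) = A"
    using U openin_subset by (metis topspace_subtopology_subset)+
  ultimately have \<alpha>: "continuous_map (subtopology (M 0) U) (subtopology ?E A) \<alpha>"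
    and \<beta>: "continuous_map (subtopology ?E A) (subtopology (M 0) U) \<beta>"
    and \<beta>\<alpha>: "\<And>u. u \<in> U \<Longrightarrow> \<beta> (\<alpha> u) = u" and \<alpha>\<beta>: "\<And>y. y \<in> A \<Longrightarrow> \<alpha> (\<beta> y) = y"
    unfolding homeomorphic_maps_def by auto
  have \<alpha>A: "\<alpha> u \<in> A" if "u \<in> U" for u
    using \<alpha> that topU continuous_map_image_subset_topspace by blast
  have \<beta>U: "\<beta> y \<in> U" if "y \<in> A" for y
    using \<beta> that topU continuous_map_image_subset_topspace by blast
  have "openin (subtopology ?E A) {y \<in> topspace (subtopology ?E A). \<beta> y \<in> U \<inter> W}"
    using assms(1) by (intro openin_continuous_map_preimage[OF \<beta>]) (auto simp: openin_subtopology)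
  moreover have "{y \<in> topspace (subtopology ?E A). \<beta> y \<in> U \<inter> W} = {y \<in> A. \<beta> y \<in> W}"
    unfolding topU using \<beta>U by blast
  ultimately have "openin ?E {y \<in> A. \<beta> y \<in> W}"
    using U(3) by (simp add: openin_open_subtopology)
  then obtain B where B: "openin ?R B" "{y \<in> A. \<beta> y \<in> W} = B \<inter> {y. \<forall>i\<ge>n. y i = 0}"
    unfolding Euclidean_space_def openin_subtopology by blast
  define v where "v = \<alpha> x"
  have "v \<in> {y \<in> A. \<beta> y \<in> W}"
    using \<alpha>A \<beta>\<alpha> U(2) assms(2) by (simp add: v_def)
  then have v: "v \<in> B" "\<And>i. i \<ge> n \<Longrightarrow> v i = 0" unfolding B(2) by auto
  obtain \<delta> where \<delta>: "\<delta> > 0"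
    "\<And>y. (\<And>i. i < n \<Longrightarrow> \<bar>y i - v i\<bar> \<le> \<delta>) \<Longrightarrow> (\<And>i. i \<ge> n \<Longrightarrow> y i = v i) \<Longrightarrow> y \<in> B"
    using powertop_real_box_neighbourhood[OF B(1) v(1)] by metis
  \<comment> \<open>\<open>Euclidean_space n\<close> consists of the sequences that vanish from
    index \<open>n\<close> on, so the sides of the box degenerate to \<open>{0}\<close>
    there.\<close>
  define a where "a i = (if i < n then v i - \<delta> else 0)" for i
  define b where "b i = (if i < n then v i + \<delta> else 0)" for i
  define Q where "Q = Pi\<^sub>E UNIV (\<lambda>i. {a i..b i})"
  have ab: "a i = b i" if "i \<ge> n" for i using that by (simp add: a_def b_def)
  have QA: "y \<in> A \<and> \<beta> y \<in> W" if "y \<in> Q" for y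
  proof -
    have i: "a i \<le> y i \<and> y i \<le> b i" for i using that by (auto simp: Q_def PiE_iff)
    have "\<bar>y i - v i\<bar> \<le> \<delta>" if "i < n" for i
      using i[of i] that by (simp add: a_def b_def abs_le_iff)
    moreover have 0: "y i = 0" if "i \<ge> n" for i
      using i[of i] that by (simp add: a_def b_def)
    ultimately have "y \<in> B" using \<delta>(2) v(2) by simp
    then have "y \<in> {y \<in> A. \<beta> y \<in> W}" using 0 unfolding B(2) by simp
    then show ?thesis by simp
  qed
  \<comment> \<open>The open box is the trace \<open>D\<close> of a product open set: openness is
    read off from \<open>G\<close>, connectedness from the description of \<open>D\<close> as a
    product of intervals and points.\<close>
  define G where "G = Pi\<^sub>E UNIV (\<lambda>i. if i < n then {v i - \<delta><..<v i + \<delta>} else UNIV)"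
  have G_open: "openin ?R G"
    unfolding G_def openin_PiE_gen
  proof (intro disjI2 conjI)
    have "{i. (if i < n then {v i - \<delta><..<v i + \<delta>} else UNIV) \<noteq> topspace euclideanreal} \<subseteq> {..<n}" by auto
    then show "finite {i \<in> UNIV. (if i < n then {v i - \<delta><..<v i + \<delta>} else UNIV) \<noteq> topspace euclideanreal}"
      using finite_subset by auto
  qed auto
  define D where "D = G \<inter> {y. \<forall>i\<ge>n. y i = 0}"
  have D_eq: "D = Pi\<^sub>E UNIV (\<lambda>i. if i < n then {v i - \<delta><..<v i + \<delta>} else {0})"
    by (force simp: D_def G_def PiE_iff split: if_splits)
  have D_conn: "connectedin ?R D"
    unfolding D_eq connectedin_PiE by auto
  have DQ: "D \<subseteq> Q"
    unfolding D_eq Q_def by (intro PiE_mono) (auto simp: a_def b_def)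
  have D_open: "openin ?E D"
    using G_open unfolding D_def Euclidean_space_def openin_subtopology by blast
  have QE: "Q \<subseteq> {y. \<forall>i\<ge>n. y i = 0}"
  proof (intro subsetI CollectI allI impI)
    fix y i assume "y \<in> Q" "n \<le> i"
    then have "a i \<le> y i \<and> y i \<le> b i" by (auto simp: Q_def PiE_iff)
    then show "y i = 0" using \<open>n \<le> i\<close> by (simp add: a_def b_def)
  qed
  define V where "V = \<beta> ` D"
  have DA: "D \<subseteq> A" using DQ QA by blast
  have V_alt: "V = {u \<in> topspace (subtopology (M 0) U). \<alpha> u \<in> D}"
    unfolding V_def topU
  proof (intro equalityI subsetI)
    fix u assume "u \<in> \<beta> ` D"
    then show "u \<in> {u \<in> U. \<alpha> u \<in> D}" using DA \<beta>U \<alpha>\<beta> by auto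
  next
    fix u assume "u \<in> {u \<in> U. \<alpha> u \<in> D}"
    then show "u \<in> \<beta> ` D" using \<beta>\<alpha> by (metis (mono_tags, lifting) image_eqI mem_Collect_eq)
  qed
  have VU: "V \<subseteq> U" using V_alt topU by blast
  have "openin (subtopology (M 0) U) V"
    unfolding V_alt using D_open DA
    by (intro openin_continuous_map_preimage[OF \<alpha>]) (auto simp: openin_open_subtopology U(3))
  then have V_open: "openin (M 0) V"
    using U(1) openin_open_subtopology by blast
  \<comment> \<open>The chart lives in a subspace of \<open>Euclidean_space n\<close>, the box lifts
    in the power of the reals; on subsets of \<open>Q\<close> both induce the same topology.\<close>
  have subEA: "subtopology (subtopology ?E A) X = subtopology ?R X" if "X \<subseteq> Q" for X
  proof -
    have "{y. \<forall>i\<ge>n. y i = 0} \<inter> (A \<inter> X) = X" using that QE QA by auto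
    then show ?thesis
      unfolding Euclidean_space_def subtopology_subtopology by (simp add: Int_assoc)
  qed
  have \<beta>Q: "continuous_map (subtopology ?R Q) (M 0) \<beta>"
    using continuous_map_from_subtopology[OF \<beta>, of Q] subEA[of Q] by (auto simp: continuous_map_in_subtopology)
  have "connectedin (subtopology ?R Q) D"
    using D_conn DQ by (simp add: connectedin_subtopology)
  from connectedin_continuous_map_image[OF \<beta>Q this]
  have V_conn: "connectedin (M 0) V" by (simp add: V_def)
  have "trivializing V"
    unfolding trivializing_def
  proof (intro conjI ballI impI V_open V_conn)
    fix s assume s: "s \<in> topspace S" "s 0 \<in> V"
    then have as: "\<alpha> (s 0) \<in> D" "s 0 \<in> U" using V_alt topU by auto
    then have "\<exists>\<sigma>. continuous_map (subtopology ?R Q) S \<sigma> \<and> (\<forall>y\<in>Q. \<sigma> y 0 = \<beta> y) \<and> \<sigma> (\<alpha> (s 0)) = s"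
      using DQ \<beta>Q \<beta>\<alpha> s(1) unfolding Q_def by (intro box_lifts_to_S[OF ab]) auto
    then obtain \<sigma> where \<sigma>: "continuous_map (subtopology ?R Q) S \<sigma>" "\<And>y. y \<in> Q \<Longrightarrow> \<sigma> y 0 = \<beta> y" "\<sigma> (\<alpha> (s 0)) = s"
      by blast
    have "continuous_map (subtopology (M 0) V) (subtopology ?E A) \<alpha>"
      by (rule continuous_map_from_subtopology_mono[OF \<alpha> VU])
    then have "continuous_map (subtopology (M 0) V) (subtopology (subtopology ?E A) Q) \<alpha>"
      unfolding continuous_map_in_subtopology using V_alt DQ by auto
    then have \<alpha>V: "continuous_map (subtopology (M 0) V) (subtopology ?R Q) \<alpha>"
      using subEA[of Q] by simp
    show "\<exists>\<sigma>. continuous_map (subtopology (M 0) V) S \<sigma> \<and> (\<forall>v\<in>V. \<sigma> v 0 = v) \<and> \<sigma> (s 0) = s"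
    proof (intro exI[of _ "\<sigma> \<circ> \<alpha>"] conjI ballI)
      show "continuous_map (subtopology (M 0) V) S (\<sigma> \<circ> \<alpha>)"
        by (rule continuous_map_compose[OF \<alpha>V \<sigma>(1)])
      fix w assume w: "w \<in> V"
      then have "\<alpha> w \<in> Q" "w \<in> U" using V_alt topU DQ by auto
      then show "(\<sigma> \<circ> \<alpha>) w 0 = w" using \<sigma>(2) \<beta>\<alpha> by simp
    qed (use \<sigma>(3) in simp)
  qed
  moreover have "v \<in> D"
    using \<delta>(1) v(2) by (auto simp: D_eq PiE_iff)
  then have "x \<in> V"
    using \<beta>\<alpha>[OF U(2)] unfolding V_def v_def by (metis image_eqI)
  moreover have "V \<subseteq> W" using QA DQ by (auto simp: V_def)
  ultimately show thesis using that by blast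
qed

section \<open>Motion along plaques, and open sheets at each level\<close>

abbreviation over :: "'a set \<Rightarrow> (nat \<Rightarrow> 'a) set" where
  "over V \<equiv> {s \<in> topspace S. s 0 \<in> V}"

text \<open>The section whose image is the plaque through \<open>s\<close>. By unique lifting all
  candidates for the choice have the same values on \<open>V\<close> when \<open>V\<close> is
  trivializing and \<open>s\<close> lies over it.\<close>

definition slide :: "'a set \<Rightarrow> (nat \<Rightarrow> 'a) \<Rightarrow> 'a \<Rightarrow> nat \<Rightarrow> 'a" where
  "slide V s = (SOME \<sigma>. continuous_map (subtopology (M 0) V) S \<sigma> \<and> (\<forall>v\<in>V. \<sigma> v 0 = v) \<and> \<sigma> (s 0) = s)"

lemma trivializing_open: "trivializing V \<Longrightarrow> openin (M 0) V"
  and trivializing_connected: "trivializing V \<Longrightarrow> connectedin (M 0) V"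
  by (simp_all add: trivializing_def)

lemma trivializing_topspace: "trivializing V \<Longrightarrow> topspace (subtopology (M 0) V) = V"
  by (meson openin_subset topspace_subtopology_subset trivializing_open)

lemma trivializing_connected_space: "trivializing V \<Longrightarrow> connected_space (subtopology (M 0) V)"
  using trivializing_connected by (simp add: connectedin_def)

lemma open_over: "openin (M 0) V \<Longrightarrow> openin S (over V)"
  by (rule openin_continuous_map_preimage[OF continuous_coordinate])

lemma
  assumes "trivializing V" "s \<in> over V"
  shows slide_continuous: "continuous_map (subtopology (M 0) V) S (slide V s)"
    and slide_base: "v \<in> V \<Longrightarrow> slide V s v 0 = v"
    and slide_self: "slide V s (s 0) = s"
proof -
  have "\<exists>\<sigma>. continuous_map (subtopology (M 0) V) S \<sigma> \<and> (\<forall>v\<in>V. \<sigma> v 0 = v) \<and> \<sigma> (s 0) = s"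
    using assms unfolding trivializing_def by blast
  from someI_ex[OF this]
  have *: "continuous_map (subtopology (M 0) V) S (slide V s) \<and> (\<forall>v\<in>V. slide V s v 0 = v) \<and> slide V s (s 0) = s"
    unfolding slide_def .
  from * show "continuous_map (subtopology (M 0) V) S (slide V s)" by blast
  from * show "v \<in> V \<Longrightarrow> slide V s v 0 = v" by blast
  from * show "slide V s (s 0) = s" by blast
qed

lemma slide_over:
  assumes "trivializing V" "s \<in> over V" "v \<in> V"
  shows "slide V s v \<in> over V"
proof -
  have "slide V s v \<in> topspace S"
    using assms(3) trivializing_topspace[OF assms(1)]
    by (intro continuous_map_image_subset_topspace[OF slide_continuous[OF assms(1,2)], THEN subsetD]) auto
  then show ?thesis
    using slide_base[OF assms] assms(3) by simp
qed

text \<open>Two sheets of level \<open>l\<close> over the connected set \<open>V\<close> are equal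
  once they meet. Hence sheets can be told apart at any chosen point of \<open>V\<close>.\<close>

lemma slide_eq_at_level:
  assumes V: "trivializing V" and "s \<in> over V" "t \<in> over V" "v \<in> V" "w \<in> V"
    and "slide V s v l = slide V t v l"
  shows "slide V s w l = slide V t w l"
proof (rule agree_at_level[OF trivializing_connected_space[OF V], where ?t0.0 = v and f = "slide V s" and g = "slide V t"])
  show "slide V s x 0 = slide V t x 0" if "x \<in> topspace (subtopology (M 0) V)" for x
    using that assms slide_base trivializing_topspace[OF V] by auto
qed (use assms trivializing_topspace[OF V] in \<open>auto intro: slide_continuous\<close>)

lemma slide_slide:
  assumes "trivializing V" "s \<in> over V" "v \<in> V" "w \<in> V"
  shows "slide V (slide V s v) w = slide V s w"
proof
  fix l
  have sv: "slide V s v \<in> over V" by (rule slide_over[OF assms(1-3)])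
  have "slide V (slide V s v) v = slide V s v"
    using slide_self[OF assms(1) sv] slide_base[OF assms(1-3)] by simp
  then show "slide V (slide V s v) w l = slide V s w l"
    using slide_eq_at_level[OF assms(1) sv assms(2,3,4)] by simp
qed

text \<open>The restriction of the larger section is a section over \<open>V\<close> through
  \<open>s\<close>, so uniqueness applies. Shrinking the trivializing set therefore does not change
  the motion.\<close>

lemma slide_subset:
  assumes V: "trivializing V" "trivializing V'" "V \<subseteq> V'" and s: "s \<in> over V" and "v \<in> V"
  shows "slide V s v = slide V' s v"
proof
  fix l
  have s': "s \<in> over V'" using s V(3) by auto
  show "slide V s v l = slide V' s v l"
  proof (rule agree_at_level[OF trivializing_connected_space[OF V(1)], where ?t0.0 = "s 0"
        and f = "slide V s" and g = "slide V' s"])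
    show "continuous_map (subtopology (M 0) V) S (slide V s)"
      by (rule slide_continuous[OF V(1) s])
    show "continuous_map (subtopology (M 0) V) S (slide V' s)"
      by (rule continuous_map_from_subtopology_mono[OF slide_continuous[OF V(2) s'] V(3)])
    show "slide V s x 0 = slide V' s x 0" if "x \<in> topspace (subtopology (M 0) V)" for x
      using that V s s' slide_base trivializing_topspace by auto
    show "slide V s (s 0) l = slide V' s (s 0) l"
      using slide_self V s s' by simp
  qed (use assms trivializing_topspace[OF V(1)] in auto)
qed

text \<open>A connected set over \<open>V\<close> lies in one plaque: on \<open>C\<close>, the map
  taking \<open>c\<close> to the point of the plaque of \<open>s\<close> over \<open>c 0\<close>
  agrees with the identity at level 0 and at \<open>s\<close>, hence everywhere.\<close>

lemma slide_in_connected: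
  assumes V: "trivializing V" and C: "connectedin S C" "C \<subseteq> over V" and s: "s \<in> C" and t: "t \<in> C" and v: "v \<in> V"
  shows "slide V s v = slide V t v"
proof
  fix l
  let ?T = "subtopology S C"
  have so: "s \<in> over V" and "to": "t \<in> over V" using C s t by auto
  have topT: "topspace ?T = C" using C(2) by auto
  have "continuous_map ?T (subtopology (M 0) V) (\<lambda>c. c 0)"
    unfolding continuous_map_in_subtopology
    using C(2) topT continuous_map_from_subtopology[OF continuous_coordinate] by auto
  from continuous_map_compose[OF this slide_continuous[OF V so]]
  have cont: "continuous_map ?T S (\<lambda>c. slide V s (c 0))" by (simp add: o_def)
  have id: "continuous_map ?T S (\<lambda>c. c)"
    by (simp add: continuous_map_from_subtopology)
  have "connected_space ?T" using C(1) by (simp add: connectedin_def)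
  then have "slide V s (t 0) l = t l"
  proof (rule agree_at_level[where ?t0.0 = s, OF _ cont id])
    show "slide V s (c 0) 0 = c 0" if "c \<in> topspace ?T" for c
      using that topT C(2) slide_base[OF V so] by auto
  qed (use s t topT slide_self[OF V so] in auto)
  then have "slide V s (t 0) l = slide V t (t 0) l"
    using slide_self[OF V "to"] by simp
  then show "slide V s v l = slide V t v l"
    using slide_eq_at_level[OF V so "to" _ v] "to" by blast
qed

lemma connected_plaque:
  assumes "trivializing V" "s \<in> over V"
  shows "connectedin S (slide V s ` V)"
  using connectedin_continuous_map_image[OF slide_continuous[OF assms], of V]
    trivializing_connected[OF assms(1)] by (simp add: connectedin_subtopology)

text \<open>By induction on the level. Near a point of the sheet the bonding map is injective, so
  pulling back an open piece of the sheet one level below yields a neighbourhood inside the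
  sheet.\<close>

lemma open_sheet:
  assumes V: "trivializing V" and s: "s \<in> over V" and B: "openin (M 0) B" "B \<subseteq> V"
  shows "openin (M l) ((\<lambda>v. slide V s v l) ` B)"
  using B
proof (induction l arbitrary: B)
  case 0
  have "(\<lambda>v. slide V s v 0) ` B = B"
    using 0(2) slide_base[OF V s] by (force simp: image_iff subset_iff)
  then show ?case using 0(1) by simp
next
  case (Suc l)
  show ?case
  proof (subst openin_subopen, intro ballI)
    fix z assume "z \<in> (\<lambda>v. slide V s v (Suc l)) ` B"
    then obtain w where w: "w \<in> B" "z = slide V s w (Suc l)" by blast
    have S: "slide V s v \<in> topspace S" if "v \<in> V" for v
      using slide_over[OF V s that] by simp
    have "z \<in> topspace (M (Suc l))"
      using w Suc.prems(2) S S_coordinate by blast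
    then obtain U where U: "openin (M (Suc l)) U" "z \<in> U" "inj_on (q (Suc l)) U"
      using covering_map_locally_injective[OF covering_q] by metis
    \<comment> \<open>Only parameters whose lift lies in \<open>U\<close> are kept: injectivity on
      \<open>U\<close> can then identify \<open>x\<close> with the lift of \<open>v\<close>.\<close>
    let ?B = "{v \<in> B. slide V s v (Suc l) \<in> U}"
    have "openin (subtopology (M 0) V) {v \<in> topspace (subtopology (M 0) V). slide V s v (Suc l) \<in> U}"
      by (rule openin_continuous_map_preimage[OF continuous_coordinate_of[OF slide_continuous[OF V s]] U(1)])
    then have "openin (M 0) {v \<in> V. slide V s v (Suc l) \<in> U}"
      using trivializing_open[OF V] trivializing_topspace[OF V] openin_open_subtopology by metis
    then have "openin (M 0) (B \<inter> {v \<in> V. slide V s v (Suc l) \<in> U})"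
      using Suc.prems(1) by blast
    also have "B \<inter> {v \<in> V. slide V s v (Suc l) \<in> U} = ?B" using Suc.prems(2) by blast
    finally have "openin (M l) ((\<lambda>v. slide V s v l) ` ?B)"
      using Suc.IH Suc.prems(2) by blast
    from openin_continuous_map_preimage[OF continuous_q this]
    have "openin (M (Suc l)) (U \<inter> {x \<in> topspace (M (Suc l)). q (Suc l) x \<in> (\<lambda>v. slide V s v l) ` ?B})"
      using U(1) by (intro openin_Int)
    moreover have "z \<in> U \<inter> {x \<in> topspace (M (Suc l)). q (Suc l) x \<in> (\<lambda>v. slide V s v l) ` ?B}"
      using U(2) w \<open>z \<in> topspace (M (Suc l))\<close> S_step[OF S[of w]] Suc.prems(2) by auto
    moreover have "U \<inter> {x \<in> topspace (M (Suc l)). q (Suc l) x \<in> (\<lambda>v. slide V s v l) ` ?B}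
        \<subseteq> (\<lambda>v. slide V s v (Suc l)) ` B"
    proof
      fix x assume x: "x \<in> U \<inter> {x \<in> topspace (M (Suc l)). q (Suc l) x \<in> (\<lambda>v. slide V s v l) ` ?B}"
      then obtain v where v: "v \<in> B" "slide V s v (Suc l) \<in> U" "q (Suc l) x = slide V s v l"
        by auto
      then have "q (Suc l) x = q (Suc l) (slide V s v (Suc l))"
        using S_step[OF S[of v]] Suc.prems(2) by auto
      then have "x = slide V s v (Suc l)"
        using inj_onD[OF U(3)] x v(2) by blast
      then show "x \<in> (\<lambda>v. slide V s v (Suc l)) ` B" using v(1) by blast
    qed
    ultimately show "\<exists>T. openin (M (Suc l)) T \<and> z \<in> T \<and> T \<subseteq> (\<lambda>v. slide V s v (Suc l)) ` B"
      by blast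
  qed
qed

section \<open>Tubes as basic neighbourhoods, and a level that is uniform over the solenoid\<close>

definition tube :: "'a set \<Rightarrow> nat \<Rightarrow> (nat \<Rightarrow> 'a) \<Rightarrow> (nat \<Rightarrow> 'a) set" where
  "tube V c s = {t \<in> over V. slide V s (t 0) c = t c}"

lemma tube_self: "trivializing V \<Longrightarrow> s \<in> over V \<Longrightarrow> s \<in> tube V c s"
  by (simp add: tube_def slide_self)

lemma tube_over: "t \<in> tube V c s \<Longrightarrow> t \<in> over V"
  by (simp add: tube_def)

lemma slide_in_tube:
  assumes "trivializing V" "s \<in> over V" "t \<in> tube V c s" "v \<in> V" "l \<le> c"
  shows "slide V s v l = slide V t v l"
proof -
  have t: "t \<in> over V" "slide V s (t 0) c = t c" using assms(3) by (auto simp: tube_def)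
  have "slide V s (t 0) l = t l"
    by (rule coordinate_eq_below[where c = c])
      (use slide_over[OF assms(1,2), of "t 0"] t assms(5) in simp_all)
  then have "slide V s (t 0) l = slide V t (t 0) l"
    using slide_self[OF assms(1) t(1)] by simp
  then show ?thesis
    using slide_eq_at_level[where v = "t 0" and l = l, OF assms(1,2) t(1) _ assms(4)] t(1) by simp
qed

text \<open>A tube is the preimage of one level-\<open>c\<close> sheet under the projection to
  \<open>M c\<close>, because the level-\<open>c\<close> coordinate already determines
  \<open>t 0\<close>. Openness of tubes follows from this form.\<close>

lemma tube_alt:
  assumes "trivializing V" "s \<in> over V"
  shows "tube V c s = {t \<in> topspace S. t c \<in> (\<lambda>v. slide V s v c) ` V}"
proof (intro equalityI subsetI)
  fix t assume "t \<in> tube V c s"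
  then show "t \<in> {t \<in> topspace S. t c \<in> (\<lambda>v. slide V s v c) ` V}"
    by (force simp: tube_def)
next
  fix t assume "t \<in> {t \<in> topspace S. t c \<in> (\<lambda>v. slide V s v c) ` V}"
  then obtain v where t: "t \<in> topspace S" "v \<in> V" "t c = slide V s v c" by blast
  have "t 0 = slide V s v 0"
    by (rule coordinate_eq_below[where c = c]) (use slide_over[OF assms t(2)] t in simp_all)
  then have "t 0 = v" using slide_base[OF assms t(2)] by simp
  then show "t \<in> tube V c s"
    using t by (simp add: tube_def)
qed

lemma open_tube:
  assumes "trivializing V" "s \<in> over V"
  shows "openin S (tube V c s)"
  unfolding tube_alt[OF assms]
  using assms trivializing_open by (intro openin_continuous_map_preimage[OF continuous_coordinate open_sheet]) auto

lemma plaque_subset_tube: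
  assumes "trivializing V" "s \<in> over V" "t \<in> tube V c s"
  shows "slide V t ` V \<subseteq> tube V c s"
proof
  fix u assume "u \<in> slide V t ` V"
  then obtain v where v: "v \<in> V" "u = slide V t v" by blast
  have t: "t \<in> over V" by (rule tube_over[OF assms(3)])
  have "slide V s v c = u c"
    using slide_in_tube[OF assms v(1) order_refl] v(2) by simp
  moreover have "u 0 = v" "u \<in> over V"
    using slide_base[OF assms(1) t v(1)] slide_over[OF assms(1) t v(1)] v(2) by simp_all
  ultimately show "u \<in> tube V c s" using v(1) by (simp add: tube_def)
qed

text \<open>A basic neighbourhood restricts one coordinate to \<open>Z\<close>. Shrinking the
  trivializing set keeps the whole level-\<open>c\<close> sheet through \<open>s\<close> inside
  \<open>Z\<close>.\<close>

lemma tube_basis: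
  assumes "openin S W" "s \<in> W"
  obtains V c where "trivializing V" "d \<le> c" "s \<in> over V" "tube V c s \<subseteq> W"
proof -
  obtain c Z where c: "d \<le> c" "openin (M c) Z" "s c \<in> Z" "\<forall>t\<in>topspace S. t c \<in> Z \<longrightarrow> t \<in> W"
    by (rule S_basis[OF assms])
  have s: "s \<in> topspace S" using assms openin_subset by blast
  obtain V' where V': "trivializing V'" "s 0 \<in> V'" "V' \<subseteq> topspace (M 0)"
    by (rule trivializing_basis[OF openin_topspace S_coordinate[OF s]])
  have so: "s \<in> over V'" using s V' by simp
  have "openin (subtopology (M 0) V') {v \<in> topspace (subtopology (M 0) V'). slide V' s v c \<in> Z}"
    by (rule openin_continuous_map_preimage[OF continuous_coordinate_of[OF slide_continuous[OF V'(1) so]] c(2)])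
  then have "openin (M 0) {v \<in> V'. slide V' s v c \<in> Z}"
    using trivializing_open[OF V'(1)] trivializing_topspace[OF V'(1)] openin_open_subtopology by metis
  moreover have "s 0 \<in> {v \<in> V'. slide V' s v c \<in> Z}"
    using V'(2) c(3) slide_self[OF V'(1) so] by simp
  ultimately obtain V where V: "trivializing V" "s 0 \<in> V" "V \<subseteq> {v \<in> V'. slide V' s v c \<in> Z}"
    by (rule trivializing_basis)
  show thesis
  proof (rule that[OF V(1) c(1)])
    show sV: "s \<in> over V" using s V by simp
    show "tube V c s \<subseteq> W"
    proof
      fix t assume t: "t \<in> tube V c s"
      then have "t 0 \<in> V" "slide V s (t 0) c = t c" "t \<in> topspace S" by (auto simp: tube_def)
      moreover have "slide V s (t 0) = slide V' s (t 0)"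
        using V V'(1) sV \<open>t 0 \<in> V\<close> by (intro slide_subset) auto
      ultimately show "t \<in> W" using c(4) V(3) by auto
    qed
  qed
qed

text \<open>A Lebesgue number lemma in which the tubes of a fixed level over small trivializing sets play
  the role of the small balls.\<close>

lemma uniform_tube_level:
  assumes op: "\<And>W. W \<in> \<W> \<Longrightarrow> openin S W" and cover: "topspace S \<subseteq> \<Union>\<W>"
  obtains c where "\<forall>x\<in>topspace (M 0).
    \<exists>V. trivializing V \<and> x \<in> V \<and> (\<forall>s\<in>over V. \<exists>W\<in>\<W>. tube V c s \<subseteq> W)"
proof -
  define P where "P = {(V, c, s). trivializing V \<and> s \<in> over V \<and> (\<exists>W\<in>\<W>. tube V c s \<subseteq> W)}"
  let ?f = "\<lambda>(V, c, s). tube V c s"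
  have "topspace S \<subseteq> \<Union> (?f ` P)"
  proof
    fix s assume "s \<in> topspace S"
    then obtain W where W: "W \<in> \<W>" "s \<in> W" using cover by blast
    obtain V c where V: "trivializing V" "0 \<le> c" "s \<in> over V" "tube V c s \<subseteq> W"
      by (rule tube_basis[OF op[OF W(1)] W(2)])
    then have "(V, c, s) \<in> P" using W(1) by (auto simp: P_def)
    then show "s \<in> \<Union> (?f ` P)"
      using tube_self[OF V(1,3)] by blast
  qed
  moreover have "\<And>U. U \<in> ?f ` P \<Longrightarrow> openin S U"
    using open_tube by (auto simp: P_def)
  ultimately obtain \<F> where F: "finite \<F>" "\<F> \<subseteq> ?f ` P" "topspace S \<subseteq> \<Union>\<F>"
    using compact_S unfolding compact_space_alt by meson
  then obtain Q where Q: "Q \<subseteq> P" "finite Q" "\<F> = ?f ` Q"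
    by (meson finite_subset_image)
  \<comment> \<open>Deeper tubes are smaller, so the largest level in the finite subcover serves all
    of its members.\<close>
  define c where "c = Max (insert 0 ((\<lambda>r. fst (snd r)) ` Q))"
  have cmax: "fst (snd r) \<le> c" if "r \<in> Q" for r
    unfolding c_def using that Q(2) by (intro Max_ge) auto
  show thesis
  proof (rule that, intro ballI)
    fix x assume x: "x \<in> topspace (M 0)"
    \<comment> \<open>The intersection of all trivializing sets of the subcover that contain
      \<open>x\<close>; whichever of them is met later, \<open>V\<close> lies inside it.\<close>
    let ?O = "topspace (M 0) \<inter> \<Inter> (fst ` {r \<in> Q. x \<in> fst r})"
    have "openin (M 0) ?O"
      using Q trivializing_open by (intro openin_Int_Inter) (auto simp: P_def)
    moreover have "x \<in> ?O" using x by auto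
    ultimately obtain V where V: "trivializing V" "x \<in> V" "V \<subseteq> ?O"
      by (rule trivializing_basis)
    have "\<exists>W\<in>\<W>. tube V c s \<subseteq> W" if s: "s \<in> over V" for s
    proof -
      \<comment> \<open>The subcover is consulted at the point over \<open>x\<close> on the plaque
        of \<open>s\<close>: a tube found there is over a set containing \<open>x\<close>, hence
        over one containing \<open>V\<close>.\<close>
      let ?s = "slide V s x"
      have so: "?s \<in> over V" "?s 0 = x"
        using slide_over[OF V(1) s V(2)] slide_base[OF V(1) s V(2)] by auto
      then obtain r where r: "r \<in> Q" "?s \<in> ?f r"
        using F(3) Q(3) by blast
      obtain U e u where rU: "r = (U, e, u)" by (cases r)
      have U: "trivializing U" "u \<in> over U" "\<exists>W\<in>\<W>. tube U e u \<subseteq> W" "?s \<in> tube U e u"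
        using r rU Q(1) by (auto simp: P_def)
      have "x \<in> U" using tube_over[OF U(4)] so(2) by simp
      then have VU: "V \<subseteq> U" using r(1) rU V(3) by fastforce
      have "e \<le> c" using cmax[OF r(1)] rU by simp
      have "tube V c s \<subseteq> tube U e u"
      proof
        fix t assume t: "t \<in> tube V c s"
        have tV: "t \<in> over V" by (rule tube_over[OF t])
        have "slide U u (t 0) e = slide U ?s (t 0) e"
          using tV VU by (intro slide_in_tube[OF U(1,2,4)]) auto
        also have "slide U ?s (t 0) = slide V ?s (t 0)"
          using tV so V(1) U(1) VU by (intro slide_subset[symmetric]) auto
        also have "\<dots> = slide V s (t 0)"
          using tV by (intro slide_slide[OF V(1) s V(2)]) auto
        also have "slide V s (t 0) e = slide V t (t 0) e"
          using tV by (intro slide_in_tube[OF V(1) s t _ \<open>e \<le> c\<close>]) auto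
        also have "slide V t (t 0) = t"
          by (rule slide_self[OF V(1) tV])
        finally show "t \<in> tube U e u"
          using tV VU by (auto simp: tube_def)
      qed
      then show ?thesis using U(3) by blast
    qed
    then show "\<exists>V. trivializing V \<and> x \<in> V \<and> (\<forall>s\<in>over V. \<exists>W\<in>\<W>. tube V c s \<subseteq> W)"
      using V by blast
  qed
qed

section \<open>Degrees of the bonding maps and cardinalities of saturated sets\<close>

definition deg :: "nat \<Rightarrow> nat" where
  "deg l = covering_degree (M l) (M (l - 1)) (q l)"

lemma has_deg: "has_covering_degree (M (Suc l)) (M l) (q (Suc l)) (deg (Suc l))"
proof -
  obtain d where d: "has_covering_degree (M (Suc l)) (M l) (q (Suc l)) d"
    using covering_degree_exists[OF finite_covering_q connected_M] by blast
  then have "covering_degree (M (Suc l)) (M l) (q (Suc l)) = d"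
    unfolding covering_degree_def
    using covering_degree_unique[OF _ _ nonempty_M] by (intro the_equality) blast+
  then show ?thesis using d by (simp add: deg_def)
qed

lemma deg_pos: "deg (Suc l) > 0"
proof -
  obtain y where y: "y \<in> topspace (M l)" using nonempty_M by blast
  then have "y \<in> q (Suc l) ` topspace (M (Suc l))"
    using covering_q[of l] by (simp add: covering_map_def)
  then have "fibre (M (Suc l)) (q (Suc l)) y \<noteq> {}" by (auto simp: fibre_def)
  then show ?thesis
    using has_deg[of l] y card_gt_0_iff unfolding has_covering_degree_def by metis
qed

text \<open>The number of sheets of \<open>M l\<close> over \<open>M 0\<close>, with the empty
  product 1 at level 0.\<close>

definition total_deg :: "nat \<Rightarrow> nat" where
  "total_deg l = (\<Prod>i=1..l. deg i)"

lemma total_deg_Suc: "total_deg (Suc l) = total_deg l * deg (Suc l)"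
  by (simp add: total_deg_def)

lemma total_deg_pos: "total_deg l > 0"
  by (induction l) (simp_all add: total_deg_Suc deg_pos total_deg_def)

lemma total_deg_dvd_mono: "k \<le> l \<Longrightarrow> total_deg k dvd total_deg l"
  unfolding total_deg_def by (intro prod_dvd_prod_subset) auto

text \<open>Saturation at level \<open>l\<close> makes the next coordinates of \<open>T\<close> a
  disjoint union of full fibres: every point of such a fibre extends to a point of the solenoid,
  which then belongs to \<open>T\<close>.\<close>

lemma card_coordinates_Suc:
  assumes T: "T \<subseteq> topspace S" and sat: "\<And>s t. s \<in> T \<Longrightarrow> t \<in> topspace S \<Longrightarrow> t l = s l \<Longrightarrow> t \<in> T"
    and fin: "finite ((\<lambda>s. s l) ` T)"
  shows "finite ((\<lambda>s. s (Suc l)) ` T)"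
    "card ((\<lambda>s. s (Suc l)) ` T) = card ((\<lambda>s. s l) ` T) * deg (Suc l)"
proof -
  let ?F = "fibre (M (Suc l)) (q (Suc l))"
  have eq: "(\<lambda>s. s (Suc l)) ` T = (\<Union>y\<in>(\<lambda>s. s l) ` T. ?F y)"
  proof (intro equalityI subsetI)
    fix z assume "z \<in> (\<lambda>s. s (Suc l)) ` T"
    then obtain s where "s \<in> T" "z = s (Suc l)" by blast
    then show "z \<in> (\<Union>y\<in>(\<lambda>s. s l) ` T. ?F y)"
      using T S_step S_coordinate by (auto simp: fibre_def subset_iff)
  next
    fix z assume "z \<in> (\<Union>y\<in>(\<lambda>s. s l) ` T. ?F y)"
    then obtain s where s: "s \<in> T" "z \<in> topspace (M (Suc l))" "q (Suc l) z = s l"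
      by (auto simp: fibre_def)
    obtain t where t: "t \<in> topspace S" "t (Suc l) = z" using S_surj[OF s(2)] by blast
    then have "t l = s l" using s(3) S_step by metis
    then have "t \<in> T" using sat s(1) t(1) by blast
    then show "z \<in> (\<lambda>s. s (Suc l)) ` T" using t(2) by blast
  qed
  have F: "finite (?F y)" "card (?F y) = deg (Suc l)" if "y \<in> (\<lambda>s. s l) ` T" for y
    using that has_deg[of l] T S_coordinate unfolding has_covering_degree_def by blast+
  show "finite ((\<lambda>s. s (Suc l)) ` T)"
    unfolding eq by (rule finite_UN_I[OF fin F(1)])
  have "card (\<Union>y\<in>(\<lambda>s. s l) ` T. ?F y) = (\<Sum>y\<in>(\<lambda>s. s l) ` T. card (?F y))"
    using fin F(1) by (intro card_UN_disjoint) (auto simp: fibre_def)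
  then show "card ((\<lambda>s. s (Suc l)) ` T) = card ((\<lambda>s. s l) ` T) * deg (Suc l)"
    unfolding eq using F(2) by simp
qed

text \<open>The proportion of sheets met stays constant from the level of saturation on, which is
  the transverse measure of \<open>T\<close>. It is written with products so that no division
  occurs.\<close>

lemma card_coordinates:
  assumes T: "T \<subseteq> topspace S" and sat: "\<And>s t. s \<in> T \<Longrightarrow> t \<in> topspace S \<Longrightarrow> t l = s l \<Longrightarrow> t \<in> T"
    and fin: "finite ((\<lambda>s. s l) ` T)" and "l \<le> e"
  shows "finite ((\<lambda>s. s e) ` T) \<and>
    card ((\<lambda>s. s e) ` T) * total_deg l = card ((\<lambda>s. s l) ` T) * total_deg e"
  using \<open>l \<le> e\<close>
proof (induction rule: dec_induct)
  case base
  then show ?case using fin by simp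
next
  case (step e)
  have sat': "t \<in> T" if "s \<in> T" "t \<in> topspace S" "t e = s e" for s t
    using sat[OF that(1,2)] coordinate_eq_below[of t s e l] that step.hyps(1) T by blast
  have "finite ((\<lambda>s. s e) ` T)" using step.IH by blast
  from card_coordinates_Suc[OF T sat' this] step.IH show ?case
    by (simp add: total_deg_Suc algebra_simps)
qed

text \<open>The fibre of the projection to \<open>M d\<close>, a compact transversal to the
  plaques.\<close>

definition cylinder :: "nat \<Rightarrow> 'a \<Rightarrow> (nat \<Rightarrow> 'a) set" where
  "cylinder d y = {s \<in> topspace S. s d = y}"

lemma cylinder_nonempty: "y \<in> topspace (M d) \<Longrightarrow> cylinder d y \<noteq> {}"
  by (metis (mono_tags, lifting) S_surj cylinder_def empty_iff mem_Collect_eq)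

lemma compactin_cylinder:
  assumes "y \<in> topspace (M d)"
  shows "compactin S (cylinder d y)"
proof -
  have "closedin (M d) {y}"
    using Hausdorff_M assms closedin_Hausdorff_singleton by metis
  from closedin_continuous_map_preimage[OF continuous_coordinate this]
  have "closedin S (cylinder d y)" by (simp add: cylinder_def)
  then show ?thesis using compact_S closedin_compact_space by blast
qed

lemma tube_antimono:
  assumes "trivializing V" "s \<in> over V" "c \<le> d"
  shows "tube V d s \<subseteq> tube V c s"
proof
  fix t assume t: "t \<in> tube V d s"
  have tV: "t \<in> over V" by (rule tube_over[OF t])
  then have "slide V s (t 0) c = slide V t (t 0) c"
    using slide_in_tube[OF assms(1,2) t _ assms(3), of "t 0"] by simp
  then show "t \<in> tube V c s"
    using slide_self[OF assms(1) tV] tV by (simp add: tube_def)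
qed

lemma cylinder_card:
  assumes "y \<in> topspace (M c)" "c \<le> d"
  shows "finite ((\<lambda>s. s d) ` cylinder c y)"
    "card ((\<lambda>s. s d) ` cylinder c y) * total_deg c = total_deg d"
proof -
  have im: "(\<lambda>s. s c) ` cylinder c y = {y}"
    using cylinder_nonempty[OF assms(1)] by (auto simp: cylinder_def)
  have "finite ((\<lambda>s. s d) ` cylinder c y) \<and>
    card ((\<lambda>s. s d) ` cylinder c y) * total_deg c = card ((\<lambda>s. s c) ` cylinder c y) * total_deg d"
    by (rule card_coordinates[OF _ _ _ assms(2)]) (auto simp: im, auto simp: cylinder_def)
  then show "finite ((\<lambda>s. s d) ` cylinder c y)"
    "card ((\<lambda>s. s d) ` cylinder c y) * total_deg c = total_deg d"
    by (simp_all add: im)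
qed

end

section \<open>Comparison of the plaques of two homeomorphic solenoids\<close>

section \<open>Homeomorphic solenoids\<close>

lemma card_image_eq_of_same_kernel:
  assumes "\<And>s t. s \<in> K \<Longrightarrow> t \<in> K \<Longrightarrow> f s = f t \<longleftrightarrow> g s = g t"
  shows "card (f ` K) = card (g ` K)"
proof (rule bij_betw_same_card)
  let ?r = "\<lambda>y. g (inv_into K f y)"
  have r: "?r (f s) = g s" if "s \<in> K" for s
    using assms[of "inv_into K f (f s)" s] that by (simp add: f_inv_into_f inv_into_into)
  show "bij_betw ?r (f ` K) (g ` K)"
    by (rule bij_betw_imageI) (auto simp: inj_on_def r assms image_image)
qed

text \<open>Both directions of the homeomorphism are data, so that interchanging them gives the
  opposite divisibility.\<close>

locale solenoid_homeomorphism = A: solenoid n M q + B: solenoid n' M' q'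
  for n :: nat and M :: "nat \<Rightarrow> 'a topology" and q and n' :: nat and M' :: "nat \<Rightarrow> 'b topology" and q' +
  fixes h :: "(nat \<Rightarrow> 'a) \<Rightarrow> nat \<Rightarrow> 'b" and g :: "(nat \<Rightarrow> 'b) \<Rightarrow> nat \<Rightarrow> 'a"
  assumes homeo: "homeomorphic_maps A.S B.S h g"
begin

lemma continuous_h: "continuous_map A.S B.S h"
  and continuous_g: "continuous_map B.S A.S g"
  and gh: "s \<in> topspace A.S \<Longrightarrow> g (h s) = s"
  and hg: "t \<in> topspace B.S \<Longrightarrow> h (g t) = t"
  using homeo by (auto simp: homeomorphic_maps_def)

lemma h_in: "s \<in> topspace A.S \<Longrightarrow> h s \<in> topspace B.S"
  using continuous_h continuous_map_image_subset_topspace by blast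

lemma g_in: "t \<in> topspace B.S \<Longrightarrow> g t \<in> topspace A.S"
  using continuous_g continuous_map_image_subset_topspace by blast

text \<open>Plaques over a tame set are small when seen in the first solenoid.\<close>

definition tame :: "'b set \<Rightarrow> bool" where
  "tame W \<longleftrightarrow> B.trivializing W \<and>
     (\<forall>t\<in>B.over W. \<exists>V. A.trivializing V \<and> (\<forall>w\<in>W. g (B.slide W t w) 0 \<in> V))"

lemma tame_trivializing: "tame W \<Longrightarrow> B.trivializing W"
  by (simp add: tame_def)

lemma tame_subset:
  assumes "tame W" "B.trivializing W'" "W' \<subseteq> W"
  shows "tame W'"
  unfolding tame_def
proof (intro conjI ballI assms(2))
  fix t assume t: "t \<in> B.over W'"
  then obtain V where V: "A.trivializing V" "\<forall>w\<in>W. g (B.slide W t w) 0 \<in> V"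
    using assms unfolding tame_def by blast
  have "g (B.slide W' t w) 0 \<in> V" if "w \<in> W'" for w
    using V(2) that assms(3) B.slide_subset[OF assms(2) tame_trivializing[OF assms(1)] assms(3) t that] by auto
  then show "\<exists>V. A.trivializing V \<and> (\<forall>w\<in>W'. g (B.slide W' t w) 0 \<in> V)"
    using V(1) by blast
qed

text \<open>The preimages under \<open>g\<close> of the sets over trivializing sets cover the second
  solenoid. A uniform tube level for this cover places each tube, and the plaque inside it, in a
  single preimage.\<close>

lemma tame_exists:
  assumes x: "x \<in> topspace (M' 0)"
  shows "\<exists>W. tame W \<and> x \<in> W"
proof -
  let ?\<W> = "{{t \<in> topspace B.S. g t \<in> A.over V} |V. A.trivializing V}"
  have "\<And>W. W \<in> ?\<W> \<Longrightarrow> openin B.S W"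
    using openin_continuous_map_preimage[OF continuous_g A.open_over[OF A.trivializing_open]] by blast
  moreover have "topspace B.S \<subseteq> \<Union>?\<W>"
  proof
    fix t assume t: "t \<in> topspace B.S"
    obtain V where "A.trivializing V" "g t 0 \<in> V" "V \<subseteq> topspace (M 0)"
      by (rule A.trivializing_basis[OF openin_topspace A.S_coordinate[OF g_in[OF t]]])
    then show "t \<in> \<Union>?\<W>" using t g_in[OF t] by blast
  qed
  ultimately obtain c where c: "\<forall>x\<in>topspace (M' 0).
    \<exists>V. B.trivializing V \<and> x \<in> V \<and> (\<forall>s\<in>B.over V. \<exists>W\<in>?\<W>. B.tube V c s \<subseteq> W)"
    by (rule B.uniform_tube_level)
  from bspec[OF c x]
  obtain W where W: "B.trivializing W" "x \<in> W" "\<forall>s\<in>B.over W. \<exists>U\<in>?\<W>. B.tube W c s \<subseteq> U"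
    by (elim exE conjE) (rule that)
  have "tame W"
    unfolding tame_def
  proof (intro conjI ballI W(1))
    fix t assume t: "t \<in> B.over W"
    then obtain V where V: "A.trivializing V" "B.tube W c t \<subseteq> {t \<in> topspace B.S. g t \<in> A.over V}"
      using bspec[OF W(3) t] by blast
    have "B.slide W t ` W \<subseteq> B.tube W c t"
      by (rule B.plaque_subset_tube[OF W(1) t B.tube_self[OF W(1) t]])
    then show "\<exists>V. A.trivializing V \<and> (\<forall>w\<in>W. g (B.slide W t w) 0 \<in> V)"
      using V by blast
  qed
  then show ?thesis using W(2) by blast
qed

text \<open>Over a tame set, pulling a plaque back to the first solenoid gives a connected set over a
  single trivializing set, which meets each fibre of the projection at most once.\<close>

lemma tame_inj:
  assumes W: "tame W" and b: "b \<in> W" and s: "s \<in> topspace A.S" "h s \<in> B.over W"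
    and t: "t \<in> topspace A.S" "h t \<in> B.over W" and "s 0 = t 0"
    and eq: "B.slide W (h s) b = B.slide W (h t) b"
  shows "s = t"
proof -
  note W' = tame_trivializing[OF W]
  let ?P = "B.slide W (h s) ` W"
  obtain V where V: "A.trivializing V" "\<forall>w\<in>W. g (B.slide W (h s) w) 0 \<in> V"
    using W s(2) unfolding tame_def by blast
  have C: "connectedin A.S (g ` ?P)"
    by (rule connectedin_continuous_map_image[OF continuous_g B.connected_plaque[OF W' s(2)]])
  have "g (B.slide W (h s) w) \<in> A.over V" if "w \<in> W" for w
    using V(2) that g_in B.slide_over[OF W' s(2) that] by simp
  then have CV: "g ` ?P \<subseteq> A.over V" by blast
  have hs: "B.slide W (h s) (h s 0) = h s"
    by (rule B.slide_self[OF W' s(2)])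
  \<comment> \<open>Equality over the single point \<open>b\<close> spreads along the plaque, so
    \<open>h t\<close> lies on the plaque of \<open>h s\<close>.\<close>
  have "B.slide W (h s) (h t 0) = B.slide W (B.slide W (h s) b) (h t 0)"
    using B.slide_slide[OF W' s(2) b, of "h t 0"] t(2) by simp
  also have "\<dots> = B.slide W (h t) (h t 0)"
    using B.slide_slide[OF W' t(2) b, of "h t 0"] t(2) eq by simp
  also have "\<dots> = h t"
    by (rule B.slide_self[OF W' t(2)])
  finally have ht: "B.slide W (h s) (h t 0) = h t" .
  have sC: "s \<in> g ` ?P"
  proof (rule image_eqI[of _ _ "h s"])
    show "s = g (h s)" using gh s(1) by simp
    show "h s \<in> ?P" using hs s(2) by (metis (mono_tags, lifting) image_eqI mem_Collect_eq)
  qed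
  have tC: "t \<in> g ` ?P"
  proof (rule image_eqI[of _ _ "h t"])
    show "t = g (h t)" using gh t(1) by simp
    show "h t \<in> ?P" using ht t(2) by (metis (mono_tags, lifting) image_eqI mem_Collect_eq)
  qed
  have so: "s \<in> A.over V" and to': "t \<in> A.over V" using sC tC CV by blast+
  have "s = A.slide V s (s 0)" by (rule A.slide_self[OF V(1) so, symmetric])
  also have "\<dots> = A.slide V t (s 0)"
    using so by (intro A.slide_in_connected[OF V(1) C CV sC tC]) simp
  also have "\<dots> = t" unfolding \<open>s 0 = t 0\<close> by (rule A.slide_self[OF V(1) to'])
  finally show "s = t" .
qed

text \<open>Counts over two overlapping members must be comparable, which calls for one tame set
  containing both. A star refinement of the tame sets provides it and survives shrinking to
  trivializing sets.\<close>

lemma tame_star_cover: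
  obtains \<W> where "\<forall>W\<in>\<W>. tame W" "topspace (M' 0) \<subseteq> \<Union>\<W>"
    "\<forall>W\<in>\<W>. \<forall>W'\<in>\<W>. W \<inter> W' \<noteq> {} \<longrightarrow> (\<exists>V. tame V \<and> W \<union> W' \<subseteq> V)"
proof -
  have cover: "topspace (M' 0) \<subseteq> \<Union> (Collect tame)"
    using tame_exists by blast
  have op: "openin (M' 0) V" if "V \<in> Collect tame" for V
    using that tame_trivializing B.trivializing_open by blast
  obtain U where U: "\<forall>x\<in>topspace (M' 0). openin (M' 0) (U x) \<and> x \<in> U x"
    "\<forall>x y. U x \<inter> U y \<noteq> {} \<longrightarrow> (\<exists>V\<in>Collect tame. U x \<union> U y \<subseteq> V)"
    by (rule compact_Hausdorff_star_refinement[OF B.compact_M B.Hausdorff_M op cover])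
  have "\<exists>W. B.trivializing W \<and> x \<in> W \<and> W \<subseteq> U x" if "x \<in> topspace (M' 0)" for x
  proof -
    have "openin (M' 0) (U x)" "x \<in> U x" using U(1) that by blast+
    then show ?thesis by (rule B.trivializing_basis) blast
  qed
  then have "\<forall>x\<in>topspace (M' 0). \<exists>W. B.trivializing W \<and> x \<in> W \<and> W \<subseteq> U x" by blast
  then obtain W where W: "\<forall>x\<in>topspace (M' 0). B.trivializing (W x) \<and> x \<in> W x \<and> W x \<subseteq> U x"
    by (rule bchoice[THEN exE])
  have star: "\<exists>V. tame V \<and> W x \<union> W y \<subseteq> V"
    if "x \<in> topspace (M' 0)" "y \<in> topspace (M' 0)" "W x \<inter> W y \<noteq> {}" for x y
  proof -
    have sub: "W x \<subseteq> U x" "W y \<subseteq> U y" using that(1,2) W by blast+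
    then have "U x \<inter> U y \<noteq> {}" using that(3) by blast
    then obtain V where "tame V" "U x \<union> U y \<subseteq> V" using U(2) by blast
    then show ?thesis using sub by blast
  qed
  show thesis
  proof (rule that[of "W ` topspace (M' 0)"]; (intro ballI impI)?)
    show "topspace (M' 0) \<subseteq> \<Union> (W ` topspace (M' 0))" using W by blast
    fix V assume "V \<in> W ` topspace (M' 0)"
    then obtain x where x: "x \<in> topspace (M' 0)" "V = W x" by blast
    then have Wx: "B.trivializing (W x)" "x \<in> W x" using W by blast+
    \<comment> \<open>The star property of \<open>x\<close> with itself already puts
      \<open>W x\<close> inside a tame set.\<close>
    then obtain V' where "tame V'" "W x \<union> W x \<subseteq> V'" using star[OF x(1) x(1)] by blast
    then show "tame V" using tame_subset[of V' "W x"] Wx x(2) by simp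
  next
    fix V V' assume "V \<in> W ` topspace (M' 0)" "V' \<in> W ` topspace (M' 0)" "V \<inter> V' \<noteq> {}"
    then show "\<exists>U. tame U \<and> V \<union> V' \<subseteq> U" by (elim imageE, hypsubst, intro star)
  qed
qed

end

section \<open>Counting the sheets met by images of cylinders\<close>

locale solenoid_homeomorphism_level = solenoid_homeomorphism n M q n' M' q' h g
  for n :: nat and M :: "nat \<Rightarrow> 'a topology" and q and n' :: nat and M' :: "nat \<Rightarrow> 'b topology" and q' h g +
  fixes \<W> :: "'b set set" and c :: nat
  assumes tame_W: "W \<in> \<W> \<Longrightarrow> tame W"
    and star_W: "W \<in> \<W> \<Longrightarrow> W' \<in> \<W> \<Longrightarrow> W \<inter> W' \<noteq> {} \<Longrightarrow> \<exists>V. tame V \<and> W \<union> W' \<subseteq> V"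
    and level_W: "x \<in> topspace (M 0) \<Longrightarrow>
      \<exists>V. A.trivializing V \<and> x \<in> V \<and> (\<forall>s\<in>A.over V. \<exists>W\<in>\<W>. \<forall>t\<in>A.tube V c s. h t \<in> B.over W)"
begin

lemma triv_W: "W \<in> \<W> \<Longrightarrow> B.trivializing W"
  using tame_W tame_trivializing by blast

definition admissible :: "'b set \<Rightarrow> nat \<Rightarrow> 'a \<Rightarrow> bool" where
  "admissible W d y \<longleftrightarrow> W \<in> \<W> \<and> (\<forall>s\<in>A.cylinder d y. h s \<in> B.over W)"

definition base :: "'b set \<Rightarrow> 'b" where
  "base W = (SOME b. b \<in> W)"

text \<open>Sliding to a common base point turns the image of a cylinder into a subset of one fibre;
  the coordinate at level \<open>e\<close> then names the level-\<open>e\<close> sheet.\<close>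

definition transport :: "'b set \<Rightarrow> (nat \<Rightarrow> 'a) \<Rightarrow> nat \<Rightarrow> 'b" where
  "transport W s = B.slide W (h s) (base W)"

text \<open>The number of level-\<open>e\<close> sheets over \<open>W\<close> met by the image of a cylinder.\<close>

definition sheet_count :: "nat \<Rightarrow> 'b set \<Rightarrow> nat \<Rightarrow> 'a \<Rightarrow> nat" where
  "sheet_count e W d y = card ((\<lambda>s. transport W s e) ` A.cylinder d y)"

lemma base_in: "h s \<in> B.over W \<Longrightarrow> base W \<in> W"
  unfolding base_def by (rule someI[of _ "h s 0"]) simp

lemma transport_over:
  assumes "W \<in> \<W>" "h s \<in> B.over W"
  shows "transport W s \<in> B.over W" "transport W s 0 = base W"
  unfolding transport_def
  using B.slide_over[OF triv_W[OF assms(1)] assms(2) base_in[OF assms(2)]]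
    B.slide_base[OF triv_W[OF assms(1)] assms(2) base_in[OF assms(2)]] by blast+

lemma transport_in_connected:
  assumes W: "W \<in> \<W>" and C: "connectedin A.S C" "\<And>s. s \<in> C \<Longrightarrow> h s \<in> B.over W" and "s \<in> C" "t \<in> C"
  shows "transport W s = transport W t"
  unfolding transport_def
proof (rule B.slide_in_connected[OF triv_W[OF W] connectedin_continuous_map_image[OF continuous_h C(1)]])
  show "base W \<in> W" using base_in C(2) \<open>s \<in> C\<close> by blast
qed (use assms in auto)

text \<open>Both motions take place in one tame set \<open>V\<close>. Two plaques over
  \<open>V\<close> share a level-\<open>e\<close> sheet at one base point exactly if they do at the
  other, so both transports identify the same pairs.\<close>

lemma sheet_count_independent:
  assumes "y \<in> topspace (M d)" and W: "admissible W d y" and W': "admissible W' d y"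
  shows "sheet_count e W d y = sheet_count e W' d y"
  unfolding sheet_count_def
proof (rule card_image_eq_of_same_kernel)
  fix s t assume s: "s \<in> A.cylinder d y" and t: "t \<in> A.cylinder d y"
  have hs: "h s \<in> B.over W" "h s \<in> B.over W'" and ht: "h t \<in> B.over W" "h t \<in> B.over W'"
    using s t W W' unfolding admissible_def by blast+
  have "W \<in> \<W>" "W' \<in> \<W>" using W W' by (auto simp: admissible_def)
  then obtain V where V: "tame V" "W \<union> W' \<subseteq> V"
    using star_W[of W W'] hs by blast
  then have V': "B.trivializing V" using tame_trivializing by blast
  have sub: "W \<subseteq> V" "W' \<subseteq> V" using V by blast+
  have hV: "h s \<in> B.over V" "h t \<in> B.over V" using hs ht sub by auto
  have "base W \<in> W" "base W' \<in> W'" using base_in hs by blast+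
  then have bV: "base W \<in> V" "base W' \<in> V" using sub by auto
  have "transport W u = B.slide V (h u) (base W)" if "h u \<in> B.over W" for u
    unfolding transport_def
    by (rule B.slide_subset[OF triv_W[OF \<open>W \<in> \<W>\<close>] V' sub(1) that \<open>base W \<in> W\<close>])
  moreover have "transport W' u = B.slide V (h u) (base W')" if "h u \<in> B.over W'" for u
    unfolding transport_def
    by (rule B.slide_subset[OF triv_W[OF \<open>W' \<in> \<W>\<close>] V' sub(2) that \<open>base W' \<in> W'\<close>])
  ultimately show "transport W s e = transport W t e \<longleftrightarrow> transport W' s e = transport W' t e"
    using B.slide_eq_at_level[OF V' hV bV, of e] B.slide_eq_at_level[OF V' hV bV(2,1), of e] hs ht by auto
qed

text \<open>Sliding over \<open>V\<close> carries the cylinder of one point of a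
  level-\<open>d\<close> sheet into that of any other. The plaques used are connected with image
  over \<open>W\<close>, so transport does not change along them. The neighbourhood is the same for
  all \<open>e\<close>.\<close>

lemma sheet_count_locally_constant:
  assumes y0: "y0 \<in> topspace (M d)" and "c \<le> d"
  shows "\<exists>Y W. openin (M d) Y \<and> y0 \<in> Y \<and>
    (\<forall>y\<in>Y. admissible W d y \<and> (\<forall>e. sheet_count e W d y = sheet_count e W d y0))"
proof -
  obtain s0 where s0: "s0 \<in> topspace A.S" "s0 d = y0" using A.S_surj[OF y0] by blast
  obtain V where V: "A.trivializing V" "s0 0 \<in> V"
    "\<forall>s\<in>A.over V. \<exists>W\<in>\<W>. \<forall>t\<in>A.tube V c s. h t \<in> B.over W"
    using level_W[OF A.S_coordinate[OF s0(1), of 0]] by blast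
  have s0V: "s0 \<in> A.over V" using s0 V by simp
  then obtain W where W: "W \<in> \<W>" "\<forall>t\<in>A.tube V c s0. h t \<in> B.over W" using V(3) by blast
  define \<sigma> where "\<sigma> w = A.slide V s0 w d" for w
  have tube: "t \<in> A.tube V d s0" if "t \<in> A.cylinder d (\<sigma> w)" "w \<in> V" for t w
    using that unfolding A.tube_alt[OF V(1) s0V] A.cylinder_def \<sigma>_def by blast
  note anti = A.tube_antimono[OF V(1) s0V \<open>c \<le> d\<close>]
  have adm: "admissible W d (\<sigma> w)" if "w \<in> V" for w
    using W tube[OF _ that] anti unfolding admissible_def by blast
  \<comment> \<open>One inclusion is enough, since \<open>w\<close> and \<open>w'\<close> are
    interchangeable.\<close>
  have sub: "(\<lambda>s. transport W s e) ` A.cylinder d (\<sigma> w) \<subseteq> (\<lambda>s. transport W s e) ` A.cylinder d (\<sigma> w')"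
    if w: "w \<in> V" "w' \<in> V" for w w' e
  proof
    fix z assume "z \<in> (\<lambda>s. transport W s e) ` A.cylinder d (\<sigma> w)"
    then obtain t where t: "t \<in> A.cylinder d (\<sigma> w)" "z = transport W t e" by blast
    have td: "t \<in> A.tube V d s0" by (rule tube[OF t(1) w(1)])
    have tV: "t \<in> A.over V" by (rule A.tube_over[OF td])
    let ?t = "A.slide V t w'"
    have "?t d = \<sigma> w'"
      using A.slide_in_tube[OF V(1) s0V td w(2) order_refl] by (simp add: \<sigma>_def)
    then have cyl: "?t \<in> A.cylinder d (\<sigma> w')"
      using A.slide_over[OF V(1) tV w(2)] by (simp add: A.cylinder_def)
    have plaque: "A.slide V t ` V \<subseteq> A.tube V c s0"
      using A.plaque_subset_tube[OF V(1) s0V] td anti by blast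
    have "t = A.slide V t (t 0)" using A.slide_self[OF V(1) tV] by simp
    then have tP: "t \<in> A.slide V t ` V" using tV by blast
    have "transport W t = transport W ?t"
      by (rule transport_in_connected[OF W(1) A.connected_plaque[OF V(1) tV] _ tP])
        (use plaque W(2) w(2) in blast)+
    then show "z \<in> (\<lambda>s. transport W s e) ` A.cylinder d (\<sigma> w')" using t(2) cyl by auto
  qed
  have y0': "y0 = \<sigma> (s0 0)" using A.slide_self[OF V(1) s0V] s0(2) by (simp add: \<sigma>_def)
  have "openin (M d) (\<sigma> ` V)"
    using A.open_sheet[OF V(1) s0V A.trivializing_open[OF V(1)] order_refl] unfolding \<sigma>_def .
  moreover have "y0 \<in> \<sigma> ` V" using y0' V(2) by blast
  moreover have "sheet_count e W d (\<sigma> w) = sheet_count e W d y0" if "w \<in> V" for w e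
    using equalityI[OF sub[OF that V(2)] sub[OF V(2) that], of e] by (simp add: sheet_count_def y0')
  ultimately show ?thesis using adm by blast
qed

text \<open>Choosing some admissible \<open>W\<close> removes it from the notation and leaves a
  function on all of \<open>M d\<close>, to which connectedness can be applied.\<close>

definition count :: "nat \<Rightarrow> nat \<Rightarrow> 'a \<Rightarrow> nat" where
  "count e d y = sheet_count e (SOME W. admissible W d y) d y"

lemma count_eq:
  assumes "y \<in> topspace (M d)" "admissible W d y"
  shows "count e d y = sheet_count e W d y"
  unfolding count_def using assms someI[of "\<lambda>W. admissible W d y" W] sheet_count_independent by blast

lemma count_constant:
  assumes "c \<le> d" "y \<in> topspace (M d)" "y' \<in> topspace (M d)"
  shows "count e d y = count e d y'"
proof (rule connected_space_locally_constant[OF A.connected_M _ assms(2,3)])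
  fix x assume x: "x \<in> topspace (M d)"
  then obtain Y W where Y: "openin (M d) Y" "x \<in> Y"
    "\<forall>y\<in>Y. admissible W d y \<and> (\<forall>e. sheet_count e W d y = sheet_count e W d x)"
    using sheet_count_locally_constant[OF x assms(1)] by blast
  have "count e d y = count e d x" if "y \<in> Y" for y
  proof -
    have "y \<in> topspace (M d)" using that openin_subset[OF Y(1)] by blast
    then have "count e d y = sheet_count e W d y" using Y(3) that by (intro count_eq) blast+
    also have "\<dots> = sheet_count e W d x" using Y(3) that by blast
    also have "\<dots> = count e d x" using Y(2,3) by (intro count_eq[OF x, symmetric]) blast
    finally show ?thesis .
  qed
  then show "\<exists>U. openin (M d) U \<and> x \<in> U \<and> (\<forall>y\<in>U. count e d y = count e d x)"
    using Y by blast
qed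

text \<open>The transported image of a cylinder is open in the fibre over the base point.\<close>

lemma transport_open:
  assumes W: "admissible W d y" and s: "s \<in> A.cylinder d y"
  shows "\<exists>e. \<forall>t\<in>topspace B.S. t e = transport W s e \<longrightarrow> t \<in> transport W ` A.cylinder d y"
proof -
  have WW: "W \<in> \<W>" and hs: "h s \<in> B.over W" using W s by (auto simp: admissible_def)
  note triv = triv_W[OF WW]
  note b = base_in[OF hs]
  have sS: "s \<in> topspace A.S" "s d = y" using s by (auto simp: A.cylinder_def)
  let ?H = "{t \<in> topspace A.S. h t \<in> B.over W}"
  have "openin A.S ?H"
    by (rule openin_continuous_map_preimage[OF continuous_h B.open_over[OF B.trivializing_open[OF triv]]])
  moreover have "s \<in> ?H" using sS hs by simp
  \<comment> \<open>With \<open>d \<le> d'\<close>, any point of the tube has level-\<open>d\<close>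
    coordinate \<open>y\<close> once it is slid over \<open>s 0\<close>.\<close>
  ultimately obtain V d' where V: "A.trivializing V" "d \<le> d'" "s \<in> A.over V" "A.tube V d' s \<subseteq> ?H"
    by (rule A.tube_basis)
  let ?O = "{t \<in> topspace B.S. g t \<in> A.tube V d' s}"
  have "openin B.S ?O"
    by (rule openin_continuous_map_preimage[OF continuous_g A.open_tube[OF V(1,3)]])
  moreover have "h s \<in> ?O" using hs gh sS(1) A.tube_self[OF V(1,3)] by simp
  ultimately obtain e Z where Z: "0 \<le> e" "openin (M' e) Z" "h s e \<in> Z"
    "\<forall>t\<in>topspace B.S. t e \<in> Z \<longrightarrow> t \<in> ?O"
    by (rule B.S_basis)
  show ?thesis
  proof (intro exI[of _ e] ballI impI)
    fix t assume t: "t \<in> topspace B.S" "t e = transport W s e"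
    have "t 0 = transport W s 0"
      by (rule B.coordinate_eq_below[where c = e]) (use t transport_over[OF WW hs] in auto)
    then have t0: "t 0 = base W" using transport_over[OF WW hs] by simp
    then have tW: "t \<in> B.over W" using t b by simp
    have tb: "B.slide W t (base W) = t" using B.slide_self[OF triv tW] t0 by simp
    \<comment> \<open>The point \<open>t\<close> is moved back over \<open>h s 0\<close>, where it
      agrees with \<open>h s\<close> at level \<open>e\<close>; this brings \<open>g u\<close> into
      the tube.\<close>
    define u where "u = B.slide W t (h s 0)"
    have uW: "u \<in> B.over W" unfolding u_def using hs by (intro B.slide_over[OF triv tW]) simp
    have "u e = B.slide W (h s) (h s 0) e"
      unfolding u_def
      by (rule B.slide_eq_at_level[OF triv tW hs b]) (use hs t(2) tb in \<open>simp_all add: transport_def\<close>)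
    also have "\<dots> = h s e" using B.slide_self[OF triv hs] by simp
    finally have gu: "g u \<in> A.tube V d' s" using Z(3,4) uW by auto
    have guV: "g u \<in> A.over V" by (rule A.tube_over[OF gu])
    have s0: "s 0 \<in> V" using V(3) by simp
    \<comment> \<open>Moving \<open>g u\<close> over \<open>s 0\<close> lands in the cylinder. The
      image under \<open>h\<close> of the plaque used stays over \<open>W\<close>, so the transport
      is still \<open>t\<close>.\<close>
    let ?s = "A.slide V (g u) (s 0)"
    have "?s d = A.slide V s (s 0) d"
      using A.slide_in_tube[OF V(1,3) gu s0 V(2)] by simp
    then have "?s d = y" using A.slide_self[OF V(1,3)] sS(2) by simp
    then have cyl: "?s \<in> A.cylinder d y"
      using A.slide_over[OF V(1) guV s0] by (simp add: A.cylinder_def)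
    have plaque: "A.slide V (g u) ` V \<subseteq> ?H"
      using A.plaque_subset_tube[OF V(1,3) gu] V(4) by blast
    have "g u = A.slide V (g u) (g u 0)" using A.slide_self[OF V(1) guV] by simp
    then have guP: "g u \<in> A.slide V (g u) ` V" using guV by blast
    have "transport W ?s = transport W (g u)"
      by (rule transport_in_connected[OF WW A.connected_plaque[OF V(1) guV] _ _ guP])
        (use plaque s0 in blast)+
    also have "\<dots> = B.slide W u (base W)" using hg uW by (simp add: transport_def)
    also have "\<dots> = B.slide W t (base W)"
      unfolding u_def using hs by (intro B.slide_slide[OF triv tW _ b]) simp
    also have "\<dots> = t" by (rule tb)
    finally show "t \<in> transport W ` A.cylinder d y" using cyl by (metis image_eqI)
  qed
qed

text \<open>The level from \<open>transport_open\<close> depends on \<open>s\<close>. By compactness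
  of the cylinder finitely many such levels suffice, and their maximum works because every point of
  \<open>N s\<close> is transported to the level-\<open>\<epsilon> s\<close> sheet of
  \<open>transport W s\<close>.\<close>

lemma transport_saturated:
  assumes y: "y \<in> topspace (M d)" and W: "admissible W d y"
  shows "\<exists>e0. \<forall>e\<ge>e0. \<forall>s\<in>A.cylinder d y. \<forall>t\<in>topspace B.S.
    t e = transport W s e \<longrightarrow> t \<in> transport W ` A.cylinder d y"
proof -
  let ?K = "A.cylinder d y"
  have WW: "W \<in> \<W>" and hW: "\<And>s. s \<in> ?K \<Longrightarrow> h s \<in> B.over W" using W by (auto simp: admissible_def)
  note triv = triv_W[OF WW]
  obtain \<epsilon> where \<epsilon>: "\<forall>s\<in>?K. \<forall>t\<in>topspace B.S. t (\<epsilon> s) = transport W s (\<epsilon> s) \<longrightarrow> t \<in> transport W ` ?K"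
    using transport_open[OF W] by metis
  define N where "N s = {u \<in> topspace A.S. h u \<in> B.tube W (\<epsilon> s) (h s)}" for s
  have "openin A.S U" if "U \<in> N ` ?K" for U
    using that unfolding N_def
    by (auto intro!: openin_continuous_map_preimage[OF continuous_h] B.open_tube[OF triv] hW)
  moreover have "s \<in> N s" if "s \<in> ?K" for s
    using that B.tube_self[OF triv hW] by (simp add: N_def A.cylinder_def)
  then have "?K \<subseteq> \<Union> (N ` ?K)" by blast
  ultimately obtain \<F> where "finite \<F>" "\<F> \<subseteq> N ` ?K" "?K \<subseteq> \<Union>\<F>"
    using compactinD[OF A.compactin_cylinder[OF y], of "N ` ?K"] by blast
  then obtain F where F: "F \<subseteq> ?K" "finite F" "?K \<subseteq> \<Union> (N ` F)"
    by (metis finite_subset_image)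
  define e0 where "e0 = Max (insert 0 (\<epsilon> ` F))"
  have e0: "\<epsilon> s \<le> e0" if "s \<in> F" for s
    unfolding e0_def using that F(2) by (intro Max_ge) auto
  have "t \<in> transport W ` ?K"
    if "e0 \<le> e" and u: "u \<in> ?K" and t: "t \<in> topspace B.S" "t e = transport W u e" for e u t
  proof -
    obtain s where s: "s \<in> F" "u \<in> N s" using F(3) u by blast
    then have sK: "s \<in> ?K" using F(1) by blast
    have "t (\<epsilon> s) = transport W u (\<epsilon> s)"
      by (rule B.coordinate_eq_below[where c = e])
        (use t transport_over[OF WW hW[OF u]] e0[OF s(1)] \<open>e0 \<le> e\<close> in auto)
    also have "transport W u (\<epsilon> s) = transport W s (\<epsilon> s)"
      using B.slide_in_tube[OF triv hW[OF sK] _ base_in[OF hW[OF sK]] order_refl, of "h u"] s(2)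
      by (simp add: transport_def N_def)
    finally show ?thesis using \<epsilon> sK t(1) by blast
  qed
  then show ?thesis by blast
qed

lemma transport_inj:
  assumes W: "admissible W c x" and s: "s \<in> A.cylinder c x" and t: "t \<in> A.cylinder c x"
    and eq: "transport W s = transport W t"
  shows "s = t"
proof -
  have WW: "W \<in> \<W>" and hs: "h s \<in> B.over W" and ht: "h t \<in> B.over W"
    using W s t by (auto simp: admissible_def)
  have S: "s \<in> topspace A.S" "t \<in> topspace A.S" "s c = t c"
    using s t by (auto simp: A.cylinder_def)
  show ?thesis
    by (rule tame_inj[OF tame_W[OF WW] base_in[OF hs] S(1) hs S(2) ht A.coordinate_eq_below[OF S(1,2,3) le0]])
      (use eq in \<open>simp add: transport_def\<close>)
qed

text \<open>The level-\<open>d\<close> pieces of one cylinder have transports occupying disjoint,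
  equally large sets of sheets, so the number of pieces divides the total count. The constant
  \<open>C = r * A.total_deg c\<close> is settled before \<open>d\<close> is given.\<close>

lemma total_deg_divides:
  "\<exists>C\<ge>1. \<forall>d. \<exists>e. A.total_deg d dvd C * B.total_deg e"
proof -
  obtain x where x: "x \<in> topspace (M c)" using A.nonempty_M by blast
  obtain W where W: "admissible W c x"
    using sheet_count_locally_constant[OF x order_refl] by blast
  let ?K = "A.cylinder c x"
  have WW: "W \<in> \<W>" and hW: "\<And>s. s \<in> ?K \<Longrightarrow> h s \<in> B.over W" using W by (auto simp: admissible_def)
  obtain e1 where e1: "\<And>e s t. e1 \<le> e \<Longrightarrow> s \<in> ?K \<Longrightarrow> t \<in> topspace B.S \<Longrightarrow> t e = transport W s e \<Longrightarrow> t \<in> transport W ` ?K"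
    using transport_saturated[OF x W] by blast
  let ?T = "transport W ` ?K"
  have TS: "?T \<subseteq> topspace B.S" using transport_over[OF WW hW] by blast
  obtain s1 where s1: "s1 \<in> ?K" using A.cylinder_nonempty[OF x] by blast
  have bM: "base W \<in> topspace (M' 0)"
    using transport_over[OF WW hW[OF s1]] B.S_coordinate[of "transport W s1" 0] by simp
  have "?T \<subseteq> B.cylinder 0 (base W)"
    using transport_over[OF WW hW] by (auto simp: B.cylinder_def)
  then have fin: "finite ((\<lambda>t. t e) ` ?T)" for e
    using finite_subset[OF image_mono B.cylinder_card(1)[OF bM le0]] by blast
  define r where "r = card ((\<lambda>t. t e1) ` ?T)"
  have r: "r > 0" unfolding r_def using fin s1 by (auto simp: card_gt_0_iff)
  have r_eq: "card ((\<lambda>t. t e) ` ?T) * B.total_deg e1 = r * B.total_deg e" if "e1 \<le> e" for e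
    using B.card_coordinates[OF TS _ fin that] e1[OF order_refl] unfolding r_def by blast
  have main: "\<exists>e. A.total_deg d dvd (r * A.total_deg c) * B.total_deg e" if d: "c \<le> d" for d
  proof -
    let ?Y = "(\<lambda>s. s d) ` ?K"
    have Y: "finite ?Y" "card ?Y * A.total_deg c = A.total_deg d"
      using A.cylinder_card[OF x d] by blast+
    have sub: "A.cylinder d y \<subseteq> ?K" and yM: "y \<in> topspace (M d)" if y: "y \<in> ?Y" for y
    proof -
      obtain s where s: "s \<in> topspace A.S" "s c = x" "y = s d"
        using y by (auto simp: A.cylinder_def)
      show "y \<in> topspace (M d)" using A.S_coordinate s by blast
      show "A.cylinder d y \<subseteq> ?K"
      proof
        fix t assume "t \<in> A.cylinder d y"
        then have t: "t \<in> topspace A.S" "t d = s d" using s(3) by (auto simp: A.cylinder_def)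
        have "t c = s c" by (rule A.coordinate_eq_below[OF t(1) s(1) t(2) d])
        then show "t \<in> ?K" using t s by (simp add: A.cylinder_def)
      qed
    qed
    have adm: "admissible W d y" if "y \<in> ?Y" for y
      using sub[OF that] W unfolding admissible_def by blast
    have "\<exists>e0. \<forall>e\<ge>e0. \<forall>s\<in>A.cylinder d y. \<forall>t\<in>topspace B.S.
      t e = transport W s e \<longrightarrow> t \<in> transport W ` A.cylinder d y" if "y \<in> ?Y" for y
      using transport_saturated[OF yM[OF that] adm[OF that]] .
    then obtain \<epsilon> where \<epsilon>: "\<forall>y\<in>?Y. \<forall>e\<ge>\<epsilon> y. \<forall>s\<in>A.cylinder d y. \<forall>t\<in>topspace B.S.
      t e = transport W s e \<longrightarrow> t \<in> transport W ` A.cylinder d y"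
      by metis
    \<comment> \<open>Beyond \<open>e1\<close>, where the size of \<open>?T\<close> is known, and so
      deep that the transport of each of the finitely many pieces is saturated.\<close>
    define e where "e = Max (insert e1 (\<epsilon> ` ?Y))"
    have e: "e1 \<le> e" "\<And>y. y \<in> ?Y \<Longrightarrow> \<epsilon> y \<le> e"
      unfolding e_def using Y(1) by (auto intro!: Max_ge)
    let ?I = "\<lambda>y. (\<lambda>s. transport W s e) ` A.cylinder d y"
    have eqU: "(\<lambda>t. t e) ` ?T = (\<Union>y\<in>?Y. ?I y)"
    proof -
      have "(\<Union>y\<in>?Y. A.cylinder d y) \<subseteq> ?K" using sub by blast
      moreover have "s \<in> A.cylinder d (s d)" if "s \<in> ?K" for s
        using that by (simp add: A.cylinder_def)
      then have "?K \<subseteq> (\<Union>y\<in>?Y. A.cylinder d y)" by blast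
      ultimately have "?K = (\<Union>y\<in>?Y. A.cylinder d y)" by (rule equalityI[rotated])
      then have "(\<lambda>s. transport W s e) ` ?K = (\<Union>y\<in>?Y. ?I y)"
        using image_UN[of "\<lambda>s. transport W s e" "A.cylinder d" ?Y] by simp
      then show ?thesis by (simp only: image_image)
    qed
    \<comment> \<open>By saturation a shared sheet would put \<open>transport W t\<close> into the
      transport of the piece over \<open>y\<close>; injectivity then gives
      \<open>t d = y\<close>.\<close>
    have disj: "?I y \<inter> ?I y' = {}" if y: "y \<in> ?Y" "y' \<in> ?Y" "y \<noteq> y'" for y y'
    proof (rule ccontr)
      assume "?I y \<inter> ?I y' \<noteq> {}"
      then obtain s t where st: "s \<in> A.cylinder d y" "t \<in> A.cylinder d y'" "transport W s e = transport W t e"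
        by blast
      have tK: "t \<in> ?K" using st(2) sub[OF y(2)] by blast
      have "transport W t \<in> topspace B.S" using transport_over[OF WW hW[OF tK]] by blast
      then have "transport W t \<in> transport W ` A.cylinder d y"
        using \<epsilon> y(1) e(2)[OF y(1)] st by metis
      then obtain u where u: "u \<in> A.cylinder d y" "transport W t = transport W u" by blast
      then have "t = u" using transport_inj[OF W tK] sub[OF y(1)] by blast
      then show False using u(1) st(2) y(3) by (simp add: A.cylinder_def)
    qed
    have finI: "finite (?I y)" if "y \<in> ?Y" for y
      using finite_subset[OF _ fin[of e]] eqU that by blast
    obtain y1 where y1: "y1 \<in> ?Y" using s1 by blast
    have "card (?I y) = count e d y1" if "y \<in> ?Y" for y
      using count_eq[OF yM[OF that] adm[OF that], of e] count_constant[OF d yM[OF that] yM[OF y1], of e]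
      unfolding sheet_count_def by (rule trans[OF sym])
    have "card ((\<lambda>t. t e) ` ?T) = card ?Y * count e d y1"

    proof -
      have "card (\<Union>y\<in>?Y. ?I y) = (\<Sum>y\<in>?Y. card (?I y))"
        by (rule card_UN_disjoint[OF Y(1)]) (use finI disj in blast)+
      also have "\<dots> = (\<Sum>y\<in>?Y. count e d y1)"
        by (rule sum.cong[OF refl]) (rule \<open>\<And>y. y \<in> ?Y \<Longrightarrow> card (?I y) = count e d y1\<close>)
      finally show ?thesis unfolding eqU by simp
    qed
    \<comment> \<open>The factor \<open>B.total_deg e1\<close> stands in for the division that
      yields the degree from level \<open>e1\<close> to level \<open>e\<close>.\<close>
    then have "r * B.total_deg e = card ?Y * (count e d y1 * B.total_deg e1)"
      unfolding r_eq[OF e(1), symmetric] by (simp only: mult.assoc)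
    then have "card ?Y dvd r * B.total_deg e" by (rule dvdI)
    then have "card ?Y * A.total_deg c dvd (r * B.total_deg e) * A.total_deg c"
      by (rule mult_dvd_mono) simp
    then show ?thesis unfolding Y(2) by (intro exI[of _ e]) (simp add: mult_ac)
  qed
  have "\<exists>e. A.total_deg d dvd (r * A.total_deg c) * B.total_deg e" for d
  proof (cases "c \<le> d")
    \<comment> \<open>Below level \<open>c\<close> the degree divides \<open>A.total_deg c\<close>,
      which is a factor of the constant.\<close>
    case False
    then have "A.total_deg d dvd A.total_deg c" by (intro A.total_deg_dvd_mono) simp
    then show ?thesis by (metis dvd_mult dvd_mult2)
  qed (rule main)
  moreover have "r * A.total_deg c \<ge> 1" using r A.total_deg_pos[of c] by simp
  ultimately show ?thesis by blast
qed

end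

text \<open>The star cover, pulled back along \<open>h\<close>, covers the first solenoid; a uniform
  tube level for that cover is the level \<open>c\<close> of the counting argument.\<close>

lemma (in solenoid_homeomorphism) total_deg_divides:
  "\<exists>C\<ge>1. \<forall>d. \<exists>e. A.total_deg d dvd C * B.total_deg e"
proof -
  obtain \<W> where W: "\<forall>W\<in>\<W>. tame W" "topspace (M' 0) \<subseteq> \<Union>\<W>"
    "\<forall>W\<in>\<W>. \<forall>W'\<in>\<W>. W \<inter> W' \<noteq> {} \<longrightarrow> (\<exists>V. tame V \<and> W \<union> W' \<subseteq> V)"
    by (rule tame_star_cover)
  let ?P = "\<lambda>W. {s \<in> topspace A.S. h s \<in> B.over W}"
  have "openin A.S U" if "U \<in> ?P ` \<W>" for U
  proof -
    from that obtain W where "W \<in> \<W>" "U = ?P W" by blast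
    then show ?thesis
      using openin_continuous_map_preimage[OF continuous_h B.open_over[OF B.trivializing_open[OF tame_trivializing]]] W(1)
      by blast
  qed
  moreover have "topspace A.S \<subseteq> \<Union> (?P ` \<W>)"
  proof
    fix s assume s: "s \<in> topspace A.S"
    then obtain W where "W \<in> \<W>" "h s 0 \<in> W"
      using B.S_coordinate[OF h_in[OF s], of 0] W(2) by blast
    then show "s \<in> \<Union> (?P ` \<W>)" using s h_in[OF s] by blast
  qed
  ultimately obtain c where c: "\<forall>x\<in>topspace (M 0).
    \<exists>V. A.trivializing V \<and> x \<in> V \<and> (\<forall>s\<in>A.over V. \<exists>U\<in>?P ` \<W>. A.tube V c s \<subseteq> U)"
    by (rule A.uniform_tube_level)
  interpret L: solenoid_homeomorphism_level n M q n' M' q' h g \<W> c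
  proof unfold_locales
    show "\<exists>V. A.trivializing V \<and> x \<in> V \<and> (\<forall>s\<in>A.over V. \<exists>W\<in>\<W>. \<forall>t\<in>A.tube V c s. h t \<in> B.over W)"
      if x: "x \<in> topspace (M 0)" for x
    proof -
      from bspec[OF c x] obtain V where V: "A.trivializing V" "x \<in> V"
        "\<forall>s\<in>A.over V. \<exists>U\<in>?P ` \<W>. A.tube V c s \<subseteq> U"
        by (elim exE conjE) (rule that)
      have "\<exists>W\<in>\<W>. \<forall>t\<in>A.tube V c s. h t \<in> B.over W" if "s \<in> A.over V" for s
        using bspec[OF V(3) that] by blast
      then show ?thesis using V(1,2) by blast
    qed
  qed (use W in blast)+
  show ?thesis by (rule L.total_deg_divides)
qed

section \<open>From divisibility of degrees to equality of types\<close>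

section \<open>Steinitz orders\<close>

lemma Lcm_exponent_le:
  fixes P P' :: "nat \<Rightarrow> nat"
  assumes pos: "C \<ge> 1" "\<And>l. P' l > 0" and mono: "\<And>l. P' l dvd P' (Suc l)"
    and dvd: "\<forall>d. \<exists>e. P d dvd C * P' e" and p: "prime p"
  shows "steinitz_exponent (steinitz_Lcm {P l |l. l > 0}) p
    \<le> enat (multiplicity p C) + steinitz_exponent (steinitz_Lcm {P' l |l. l > 0}) p"
proof -
  let ?\<chi> = "SUP a\<in>{P' l |l. l > 0}. enat (multiplicity p a)"
  have "enat (multiplicity p (P l)) \<le> enat (multiplicity p C) + ?\<chi>" for l
  proof -
    obtain e where "P l dvd C * P' e" using dvd by blast
    \<comment> \<open>The least common multiple runs over positive indices only, so a possible
      \<open>e = 0\<close> is replaced by \<open>Suc e\<close>.\<close>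
    also have "C * P' e dvd C * P' (Suc e)" using mono by (intro mult_dvd_mono) auto
    finally have "multiplicity p (P l) \<le> multiplicity p (C * P' (Suc e))"
      using pos(1) pos(2)[of "Suc e"] by (intro dvd_imp_multiplicity_le) auto
    also have "\<dots> = multiplicity p C + multiplicity p (P' (Suc e))"
      using p pos(1) pos(2)[of "Suc e"] by (intro prime_elem_multiplicity_mult_distrib) auto
    finally have "enat (multiplicity p (P l)) \<le> enat (multiplicity p C) + enat (multiplicity p (P' (Suc e)))"
      by simp
    also have "enat (multiplicity p (P' (Suc e))) \<le> ?\<chi>"
      by (rule SUP_upper) blast
    finally show ?thesis by (simp add: add_left_mono)
  qed
  then have "(SUP a\<in>{P l |l. l > 0}. enat (multiplicity p a)) \<le> enat (multiplicity p C) + ?\<chi>"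
    by (intro SUP_least) auto
  then show ?thesis using p by (simp add: steinitz_Lcm.rep_eq)
qed

text \<open>The exponents can differ only at the finitely many primes dividing
  \<open>C * C'\<close>, and at each prime they are both finite or both infinite.\<close>

lemma asymptotically_equivalentI:
  assumes pos: "C \<ge> 1" "C' \<ge> 1"
    and le: "\<And>p. prime p \<Longrightarrow> steinitz_exponent \<xi> p \<le> enat (multiplicity p C) + steinitz_exponent \<xi>' p"
    and ge: "\<And>p. prime p \<Longrightarrow> steinitz_exponent \<xi>' p \<le> enat (multiplicity p C') + steinitz_exponent \<xi> p"
  shows "asymptotically_equivalent \<xi> \<xi>'"
proof -
  let ?\<chi> = "steinitz_exponent \<xi>" and ?\<chi>' = "steinitz_exponent \<xi>'"
  define F where "F = prime_factors (C * C')"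
  \<comment> \<open>Each multiplier takes its exponents from the other Steinitz number, so both
    products have the sum of the two exponents on \<open>F\<close>. If the exponents are infinite,
    any value of \<open>the_enat\<close> gives equality.\<close>
  define m where "m = (\<Prod>p\<in>F. p ^ the_enat (?\<chi>' p))"
  define m' where "m' = (\<Prod>p\<in>F. p ^ the_enat (?\<chi> p))"
  have F: "finite F" "\<And>p. p \<in> F \<Longrightarrow> prime p" by (auto simp: F_def)
  have mult: "multiplicity p m = (if p \<in> F then the_enat (?\<chi>' p) else 0)"
    "multiplicity p m' = (if p \<in> F then the_enat (?\<chi> p) else 0)" if "prime p" for p
    unfolding m_def m'_def using multiplicity_prod_prime_powers[OF F that] by auto
  have "steinitz_exponent (steinitz_of_nat m * \<xi>) p = steinitz_exponent (steinitz_of_nat m' * \<xi>') p" for p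
  proof (cases "prime p")
    case False
    then show ?thesis using steinitz_exponent[of "steinitz_of_nat m * \<xi>"]
        steinitz_exponent[of "steinitz_of_nat m' * \<xi>'"] by simp
  next
    case p: True
    have "enat (multiplicity p m) + ?\<chi> p = enat (multiplicity p m') + ?\<chi>' p"
    proof (cases "p \<in> F")
      case True
      show ?thesis
        using le[OF p] ge[OF p] True by (cases "?\<chi> p"; cases "?\<chi>' p") (auto simp: mult[OF p])
    next
      case False
      then have "\<not> p dvd C * C'"
        using p pos by (auto simp: F_def prime_factors_dvd)
      then have "multiplicity p C = 0" "multiplicity p C' = 0"
        by (auto intro!: not_dvd_imp_multiplicity_0)
      then show ?thesis
        using le[OF p] ge[OF p] False by (simp add: mult[OF p] flip: zero_enat_def)
    qed
    then show ?thesis using p by (simp add: times_steinitz.rep_eq steinitz_of_nat.rep_eq)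
  qed
  then have "steinitz_of_nat m * \<xi> = steinitz_of_nat m' * \<xi>'"
    by (simp add: steinitz_exponent_inject[symmetric] fun_eq_iff)
  moreover have "m \<ge> 1" "m' \<ge> 1"
    unfolding m_def m'_def using F by (auto simp: Suc_le_eq intro!: prod_pos prime_gt_0_nat)
  ultimately show ?thesis
    unfolding asymptotically_equivalent_def by blast
qed

text \<open>The products start at index 1 and involve only degrees that are forced, because the base
  spaces are nonempty. Existence and uniqueness of the order both follow.\<close>

lemma (in solenoid) is_steinitz_order_iff:
  "is_steinitz_order M q \<xi> \<longleftrightarrow> \<xi> = steinitz_Lcm {total_deg l |l. l > 0}"
proof
  assume "is_steinitz_order M q \<xi>"
  then obtain m where m: "\<forall>l\<ge>1. has_covering_degree (M l) (M (l - 1)) (q l) (m l)"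
    "\<xi> = steinitz_Lcm {\<Prod>i=1..l. m i |l. l > 0}"
    unfolding is_steinitz_order_def by blast
  have "m (Suc l) = deg (Suc l)" for l
  proof (rule covering_degree_unique[OF _ has_deg nonempty_M])
    show "has_covering_degree (M (Suc l)) (M l) (q (Suc l)) (m (Suc l))"
      using spec[OF m(1), of "Suc l"] by simp
  qed
  then have "m i = deg i" if "i \<in> {1..l}" for i l
    using that by (cases i) auto
  then have "(\<Prod>i=1..l. m i) = total_deg l" for l
    unfolding total_deg_def by (intro prod.cong) auto
  then show "\<xi> = steinitz_Lcm {total_deg l |l. l > 0}" using m(2) by simp
next
  have "has_covering_degree (M l) (M (l - 1)) (q l) (deg l)" if "l \<ge> 1" for l
    using that has_deg[of "l - 1"] by (cases l) auto
  moreover assume "\<xi> = steinitz_Lcm {total_deg l |l. l > 0}"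
  ultimately show "is_steinitz_order M q \<xi>"
    unfolding is_steinitz_order_def total_deg_def by (intro exI[of _ deg] conjI allI impI)
qed

lemma (in solenoid) steinitz_order_eq: "steinitz_order M q = steinitz_Lcm {total_deg l |l. l > 0}"
  by (simp add: steinitz_order_def is_steinitz_order_iff)

lemma (in solenoid_homeomorphism) asymptotically_equivalent_orders:
  "asymptotically_equivalent (steinitz_order M q) (steinitz_order M' q')"
proof -
  \<comment> \<open>The roles of the solenoids are exchanged; the second divisibility comes with its
    own constant.\<close>
  interpret inv: solenoid_homeomorphism n' M' q' n M q g h
    by unfold_locales (rule homeomorphic_maps_sym[THEN iffD1, OF homeo])
  from total_deg_divides obtain C where C: "C \<ge> 1" "\<forall>d. \<exists>e. A.total_deg d dvd C * B.total_deg e"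
    by (elim exE conjE) (rule that)
  from inv.total_deg_divides obtain C' where C': "C' \<ge> 1" "\<forall>d. \<exists>e. B.total_deg d dvd C' * A.total_deg e"
    by (elim exE conjE) (rule that)
  note Suc_dvd = A.total_deg_dvd_mono[OF le_SucI[OF order_refl]] B.total_deg_dvd_mono[OF le_SucI[OF order_refl]]
  show ?thesis
    unfolding A.steinitz_order_eq B.steinitz_order_eq
    by (rule asymptotically_equivalentI[OF C(1) C'(1)])
      (rule Lcm_exponent_le[OF C(1) B.total_deg_pos Suc_dvd(2) C(2)]
        Lcm_exponent_le[OF C'(1) A.total_deg_pos Suc_dvd(1) C'(2)], assumption)+
qed

theorem theorem1p14:
  fixes n :: nat and M :: "nat \<Rightarrow> 'a topology" and q :: "nat \<Rightarrow> 'a \<Rightarrow> 'a"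
  assumes "presentation n M q"
  shows "(\<exists>!\<xi>. is_steinitz_order M q \<xi>) \<and>
    (\<forall>n' (M' :: nat \<Rightarrow> 'b topology) (q' :: nat \<Rightarrow> 'b \<Rightarrow> 'b).
       presentation n' M' q' \<longrightarrow>
       solenoidal_manifold M q homeomorphic_space solenoidal_manifold M' q' \<longrightarrow>
       steinitz_type (steinitz_order M q) = steinitz_type (steinitz_order M' q'))"
proof (intro conjI allI impI)
  interpret solenoid n M q by standard (rule assms)
  show "\<exists>!\<xi>. is_steinitz_order M q \<xi>" by (simp add: is_steinitz_order_iff)
next
  fix n' and M' :: "nat \<Rightarrow> 'b topology" and q' :: "nat \<Rightarrow> 'b \<Rightarrow> 'b"
  assume pres': "presentation n' M' q'"
    and "solenoidal_manifold M q homeomorphic_space solenoidal_manifold M' q'"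
  then obtain h g where hg: "homeomorphic_maps (solenoidal_manifold M q) (solenoidal_manifold M' q') h g"
    unfolding homeomorphic_space_def by blast
  interpret solenoid_homeomorphism n M q n' M' q' h g
    by unfold_locales (use assms pres' hg in blast)+
  show "steinitz_type (steinitz_order M q) = steinitz_type (steinitz_order M' q')"
    unfolding steinitz_type_eq_iff by (rule asymptotically_equivalent_orders)
qed

end
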